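(* Let $\mathcal M$ be a countable model of $\mathrm{PA}$ such that $\mathcal M\not\models \mathrm{Th}(\mathbb N)$. Then $SR(\mathcal M)\geq\omega$.
   Context: $\mathrm{Th}(\mathbb N)$ is true arithmetic, the complete theory of the standard model. $SR(\mathcal M)$, the (parameterless) Scott rank, is the least countable ordinal $\alpha$ such that every automorphism orbit of a finite tuple of $\mathcal M$ is definable without parameters by a $\Sigma^{\mathrm{in}}_\alpha$ formula of $L_{\omega_1\omega}$. *)

theory Defs
  imports "HOL-Library.Countable_Set"
begin

text \<open>Order types of well-orders whose field is a set of natural numbers.\<close>

quotient_type cord = "nat rel" / partial: "\<lambda>r s :: nat rel. (r, s) \<in> ordIso"
proof (rule part_equivpI)
  show "\<exists>r :: nat rel. (r, r) \<in> ordIso"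
    using natLeq_Well_order ordIso_reflexive by blast
  show "symp (\<lambda>r s :: nat rel. (r, s) \<in> ordIso)"
    by (rule sympI) (rule ordIso_symmetric)
  show "transp (\<lambda>r s :: nat rel. (r, s) \<in> ordIso)"
    by (rule transpI) (rule ordIso_transitive)
qed

lemma ordIso_self_iff: "(r, r) \<in> ordIso \<longleftrightarrow> Well_order r"
  using ordIso_reflexive by (auto simp: ordIso_def)

instantiation cord :: wellorder
begin

lift_definition less_eq_cord :: "cord \<Rightarrow> cord \<Rightarrow> bool" is "\<lambda>r s. (r, s) \<in> ordLeq"
  by (meson ordIso_ordLeq_trans ordIso_symmetric ordLeq_ordIso_trans)

lift_definition less_cord :: "cord \<Rightarrow> cord \<Rightarrow> bool" is "\<lambda>r s. (r, s) \<in> ordLess"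
  by (meson ordIso_ordLess_trans ordIso_symmetric ordLess_ordIso_trans)

instance
proof
  fix x y z :: cord
  show "x < y \<longleftrightarrow> x \<le> y \<and> \<not> y \<le> x"
    by transfer (metis ordIso_self_iff not_ordLeq_iff_ordLess ordLess_imp_ordLeq)
  show "x \<le> x"
    by transfer (metis ordIso_self_iff ordLeq_reflexive)
  show "x \<le> y \<Longrightarrow> y \<le> z \<Longrightarrow> x \<le> z"
    by transfer (metis ordLeq_transitive)
  show "x \<le> y \<Longrightarrow> y \<le> x \<Longrightarrow> x = y"
    by transfer (metis ordIso_iff_ordLeq)
  show "x \<le> y \<or> y \<le> x"
    by transfer (metis ordIso_self_iff ordLeq_total)
next
  fix P :: "cord \<Rightarrow> bool" and a :: cord
  assume step: "\<And>x. (\<And>y. y < x \<Longrightarrow> P y) \<Longrightarrow> P x"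
  have *: "Well_order r \<longrightarrow> P (abs_cord r)" for r
  proof (induction r rule: wf_induct_rule[OF wf_ordLess])
    case (1 r)
    show ?case
    proof
      assume r: "Well_order r"
      show "P (abs_cord r)"
      proof (rule step)
        fix y assume "y < abs_cord r"
        then show "P y"
        proof (induction y rule: cord.abs_induct)
          case (1 s)
          then have "(s, r) \<in> ordLess"
            using r by (simp add: less_cord.abs_eq ordIso_self_iff)
          then show ?case using "1.hyps" \<open>\<And>y. (y, r) \<in> ordLess \<Longrightarrow> Well_order y \<longrightarrow> P (abs_cord y)\<close>
            by (simp add: ordIso_self_iff)
        qed
      qed
    qed
  qed
  show "P a"
    by (induction a rule: cord.abs_induct) (simp add: * ordIso_self_iff)
qed

end

instantiation cord :: zero
begin

lift_definition zero_cord :: cord is "{} :: nat rel"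
  using well_order_on_empty by (simp add: ordIso_self_iff)

instance ..

end

lift_definition omega :: cord is natLeq
  by (rule ordIso_reflexive[OF natLeq_Well_order])


datatype tm = Var nat | Zero | One | Add tm tm | Mul tm tm

text \<open>
  Variables are de Bruijn indices: \<open>Exists\<close> and \<open>Forall\<close> bind index 0. The constructors \<open>CConj I f\<close>
  and \<open>CDisj I f\<close> are the countable conjunction and disjunction of the family \<open>f i\<close>, \<open>i \<in> I\<close>;
  the first-order formulas are those in which neither occurs.
\<close>

datatype fm =
    Eq tm tm
  | Lt tm tm
  | Neg fm
  | And fm fm
  | Or fm fm
  | Exists fm
  | Forall fm
  | CConj "nat set" "nat \<Rightarrow> fm"
  | CDisj "nat set" "nat \<Rightarrow> fm"

abbreviation Imp :: "fm \<Rightarrow> fm \<Rightarrow> fm" where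
  "Imp \<phi> \<psi> \<equiv> Or (Neg \<phi>) \<psi>"

primrec finitary :: "fm \<Rightarrow> bool" where
  "finitary (Eq s t) = True"
| "finitary (Lt s t) = True"
| "finitary (Neg \<phi>) = finitary \<phi>"
| "finitary (And \<phi> \<psi>) = (finitary \<phi> \<and> finitary \<psi>)"
| "finitary (Or \<phi> \<psi>) = (finitary \<phi> \<and> finitary \<psi>)"
| "finitary (Exists \<phi>) = finitary \<phi>"
| "finitary (Forall \<phi>) = finitary \<phi>"
| "finitary (CConj I f) = False"
| "finitary (CDisj I f) = False"

primrec quantifier_free :: "fm \<Rightarrow> bool" where
  "quantifier_free (Eq s t) = True"
| "quantifier_free (Lt s t) = True"
| "quantifier_free (Neg \<phi>) = quantifier_free \<phi>"
| "quantifier_free (And \<phi> \<psi>) = (quantifier_free \<phi> \<and> quantifier_free \<psi>)"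
| "quantifier_free (Or \<phi> \<psi>) = (quantifier_free \<phi> \<and> quantifier_free \<psi>)"
| "quantifier_free (Exists \<phi>) = False"
| "quantifier_free (Forall \<phi>) = False"
| "quantifier_free (CConj I f) = (\<forall>i\<in>I. quantifier_free (f i))"
| "quantifier_free (CDisj I f) = (\<forall>i\<in>I. quantifier_free (f i))"

primrec fv_tm :: "tm \<Rightarrow> nat set" where
  "fv_tm (Var n) = {n}"
| "fv_tm Zero = {}"
| "fv_tm One = {}"
| "fv_tm (Add s t) = fv_tm s \<union> fv_tm t"
| "fv_tm (Mul s t) = fv_tm s \<union> fv_tm t"

primrec fv :: "fm \<Rightarrow> nat set" where
  "fv (Eq s t) = fv_tm s \<union> fv_tm t"
| "fv (Lt s t) = fv_tm s \<union> fv_tm t"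
| "fv (Neg \<phi>) = fv \<phi>"
| "fv (And \<phi> \<psi>) = fv \<phi> \<union> fv \<psi>"
| "fv (Or \<phi> \<psi>) = fv \<phi> \<union> fv \<psi>"
| "fv (Exists \<phi>) = {n. Suc n \<in> fv \<phi>}"
| "fv (Forall \<phi>) = {n. Suc n \<in> fv \<phi>}"
| "fv (CConj I f) = (\<Union>i\<in>I. fv (f i))"
| "fv (CDisj I f) = (\<Union>i\<in>I. fv (f i))"

primrec subst_tm :: "(nat \<Rightarrow> tm) \<Rightarrow> tm \<Rightarrow> tm" where
  "subst_tm \<sigma> (Var n) = \<sigma> n"
| "subst_tm \<sigma> Zero = Zero"
| "subst_tm \<sigma> One = One"
| "subst_tm \<sigma> (Add s t) = Add (subst_tm \<sigma> s) (subst_tm \<sigma> t)"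
| "subst_tm \<sigma> (Mul s t) = Mul (subst_tm \<sigma> s) (subst_tm \<sigma> t)"

definition lift_subst :: "(nat \<Rightarrow> tm) \<Rightarrow> nat \<Rightarrow> tm" where
  "lift_subst \<sigma> = case_nat (Var 0) (\<lambda>n. subst_tm (\<lambda>m. Var (Suc m)) (\<sigma> n))"

primrec subst_fm :: "(nat \<Rightarrow> tm) \<Rightarrow> fm \<Rightarrow> fm" where
  "subst_fm \<sigma> (Eq s t) = Eq (subst_tm \<sigma> s) (subst_tm \<sigma> t)"
| "subst_fm \<sigma> (Lt s t) = Lt (subst_tm \<sigma> s) (subst_tm \<sigma> t)"
| "subst_fm \<sigma> (Neg \<phi>) = Neg (subst_fm \<sigma> \<phi>)"
| "subst_fm \<sigma> (And \<phi> \<psi>) = And (subst_fm \<sigma> \<phi>) (subst_fm \<sigma> \<psi>)"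
| "subst_fm \<sigma> (Or \<phi> \<psi>) = Or (subst_fm \<sigma> \<phi>) (subst_fm \<sigma> \<psi>)"
| "subst_fm \<sigma> (Exists \<phi>) = Exists (subst_fm (lift_subst \<sigma>) \<phi>)"
| "subst_fm \<sigma> (Forall \<phi>) = Forall (subst_fm (lift_subst \<sigma>) \<phi>)"
| "subst_fm \<sigma> (CConj I f) = CConj I (\<lambda>i. subst_fm \<sigma> (f i))"
| "subst_fm \<sigma> (CDisj I f) = CDisj I (\<lambda>i. subst_fm \<sigma> (f i))"


text \<open>The universe of a structure of type \<open>'a arith\<close> is the whole type \<open>'a\<close>.\<close>

record 'a arith =
  Z :: 'a
  U :: 'a
  plus_op :: "'a \<Rightarrow> 'a \<Rightarrow> 'a"
  times_op :: "'a \<Rightarrow> 'a \<Rightarrow> 'a"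
  less_rel :: "'a \<Rightarrow> 'a \<Rightarrow> bool"

primrec eval :: "'a arith \<Rightarrow> (nat \<Rightarrow> 'a) \<Rightarrow> tm \<Rightarrow> 'a" where
  "eval M e (Var n) = e n"
| "eval M e Zero = Z M"
| "eval M e One = U M"
| "eval M e (Add s t) = plus_op M (eval M e s) (eval M e t)"
| "eval M e (Mul s t) = times_op M (eval M e s) (eval M e t)"

primrec sat :: "'a arith \<Rightarrow> (nat \<Rightarrow> 'a) \<Rightarrow> fm \<Rightarrow> bool" where
  "sat M e (Eq s t) \<longleftrightarrow> eval M e s = eval M e t"
| "sat M e (Lt s t) \<longleftrightarrow> less_rel M (eval M e s) (eval M e t)"
| "sat M e (Neg \<phi>) \<longleftrightarrow> \<not> sat M e \<phi>"
| "sat M e (And \<phi> \<psi>) \<longleftrightarrow> sat M e \<phi> \<and> sat M e \<psi>"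
| "sat M e (Or \<phi> \<psi>) \<longleftrightarrow> sat M e \<phi> \<or> sat M e \<psi>"
| "sat M e (Exists \<phi>) \<longleftrightarrow> (\<exists>a. sat M (case_nat a e) \<phi>)"
| "sat M e (Forall \<phi>) \<longleftrightarrow> (\<forall>a. sat M (case_nat a e) \<phi>)"
| "sat M e (CConj I f) \<longleftrightarrow> (\<forall>i\<in>I. sat M e (f i))"
| "sat M e (CDisj I f) \<longleftrightarrow> (\<exists>i\<in>I. sat M e (f i))"

text \<open>A member of \<open>T\<close> with free variables stands for its universal closure.\<close>

definition models :: "'a arith \<Rightarrow> fm set \<Rightarrow> bool" (infix "\<Turnstile>" 50) where
  "M \<Turnstile> T \<longleftrightarrow> (\<forall>\<phi>\<in>T. \<forall>e. sat M e \<phi>)"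


text \<open>The axioms of discretely ordered semirings.\<close>

definition PA_minus :: "fm set" where
  "PA_minus = (let x = Var 0; y = Var 1; z = Var 2 in
    { Eq (Add (Add x y) z) (Add x (Add y z)),
      Eq (Add x y) (Add y x),
      Eq (Mul (Mul x y) z) (Mul x (Mul y z)),
      Eq (Mul x y) (Mul y x),
      Eq (Mul x (Add y z)) (Add (Mul x y) (Mul x z)),
      Eq (Add x Zero) x,
      Eq (Mul x Zero) Zero,
      Eq (Mul x One) x,
      Imp (And (Lt x y) (Lt y z)) (Lt x z),
      Neg (Lt x x),
      Or (Lt x y) (Or (Eq x y) (Lt y x)),
      Imp (Lt x y) (Lt (Add x z) (Add y z)),
      Imp (And (Lt Zero z) (Lt x y)) (Lt (Mul x z) (Mul y z)),
      \<comment> \<open>\<open>x < y \<longrightarrow> (\<exists>z. x + z = y)\<close>, with \<open>x\<close> and \<open>y\<close> shifted below the quantifier\<close>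
      Imp (Lt x y) (Exists (Eq (Add (Var 1) (Var 0)) (Var 2))),
      Lt Zero One,
      Imp (Lt Zero x) (Or (Eq One x) (Lt One x)),
      Or (Eq Zero x) (Lt Zero x) })"

text \<open>
  Induction on the variable with index 0; the other free variables of \<open>\<phi>\<close> are parameters.
  The two substitutions give \<open>\<phi>(0)\<close>, outside the quantifier, and \<open>\<phi>(x + 1)\<close>, below it.
\<close>

definition induction_axiom :: "fm \<Rightarrow> fm" where
  "induction_axiom \<phi> =
     Imp (And (subst_fm (case_nat Zero Var) \<phi>)
              (Forall (Imp \<phi> (subst_fm (case_nat (Add (Var 0) One) (\<lambda>n. Var (Suc n))) \<phi>))))
         (Forall \<phi>)"

definition PA :: "fm set" where
  "PA = PA_minus \<union> {induction_axiom \<phi> | \<phi>. finitary \<phi>}"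

definition standard_model :: "nat arith" where
  "standard_model = \<lparr>Z = 0, U = 1, plus_op = (+), times_op = (*), less_rel = (<)\<rparr>"

definition true_arithmetic :: "fm set" where
  "true_arithmetic = {\<phi>. finitary \<phi> \<and> fv \<phi> = {} \<and> standard_model \<Turnstile> {\<phi>}}"


inductive is_Sigma :: "cord \<Rightarrow> fm \<Rightarrow> bool" and is_Pi :: "cord \<Rightarrow> fm \<Rightarrow> bool" where
  Sigma_0: "finitary \<phi> \<Longrightarrow> quantifier_free \<phi> \<Longrightarrow> is_Sigma 0 \<phi>"
| Pi_0: "finitary \<phi> \<Longrightarrow> quantifier_free \<phi> \<Longrightarrow> is_Pi 0 \<phi>"
| Sigma_pos: "0 < \<alpha> \<Longrightarrow> (\<And>i. i \<in> I \<Longrightarrow> \<beta> i < \<alpha>) \<Longrightarrow> (\<And>i. i \<in> I \<Longrightarrow> is_Pi (\<beta> i) (\<psi> i)) \<Longrightarrow>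
    is_Sigma \<alpha> (CDisj I (\<lambda>i. (Exists ^^ k i) (\<psi> i)))"
| Pi_pos: "0 < \<alpha> \<Longrightarrow> (\<And>i. i \<in> I \<Longrightarrow> \<beta> i < \<alpha>) \<Longrightarrow> (\<And>i. i \<in> I \<Longrightarrow> is_Sigma (\<beta> i) (\<psi> i)) \<Longrightarrow>
    is_Pi \<alpha> (CConj I (\<lambda>i. (Forall ^^ k i) (\<psi> i)))"

definition automorphism :: "'a arith \<Rightarrow> ('a \<Rightarrow> 'a) \<Rightarrow> bool" where
  "automorphism M h \<longleftrightarrow> bij h \<and> h (Z M) = Z M \<and> h (U M) = U M \<and>
     (\<forall>a b. h (plus_op M a b) = plus_op M (h a) (h b)) \<and>
     (\<forall>a b. h (times_op M a b) = times_op M (h a) (h b)) \<and>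
     (\<forall>a b. less_rel M (h a) (h b) \<longleftrightarrow> less_rel M a b)"

definition orbit :: "'a arith \<Rightarrow> 'a list \<Rightarrow> 'a list set" where
  "orbit M as = {map h as | h. automorphism M h}"

text \<open>
  The bound on the free variables of \<open>\<phi>\<close> also ensures that every subformula of a formula in
  the hierarchy has only finitely many free variables, since quantifier blocks are finite.
\<close>

definition defined_by :: "'a arith \<Rightarrow> nat \<Rightarrow> fm \<Rightarrow> 'a list set \<Rightarrow> bool" where
  "defined_by M n \<phi> D \<longleftrightarrow> fv \<phi> \<subseteq> {..<n} \<and> (\<forall>e. sat M e \<phi> \<longleftrightarrow> map e [0..<n] \<in> D)"

text \<open>For countable \<open>M\<close> the least ordinal exists, by Scott's theorem.\<close>

definition scott_rank :: "'a arith \<Rightarrow> cord" where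
  "scott_rank M =
     (LEAST \<alpha>. \<forall>as. \<exists>\<phi>. is_Sigma \<alpha> \<phi> \<and> defined_by M (length as) \<phi> (orbit M as))"

end

theory Submission
  imports Defs
begin

text \<open>
  If \<open>M\<close> does not satisfy true arithmetic, then some nonstandard element is fixed by all
  automorphisms: otherwise the least witness of a formula with standard parameters would always be
  standard, and the standard model would be an elementary substructure by the Tarski--Vaught test.

  For each \<open>n\<close> there is a first-order formula in \<open>c\<close>, \<open>x\<close>, \<open>y\<close> expressing that \<open>x\<close> and \<open>y\<close> cannot be
  separated in \<open>n\<close> rounds of a back-and-forth game whose moves are codes of sequences and whose atomic
  comparisons are restricted to indices below \<open>c\<close>. For standard \<open>c\<close> this is an equivalence of
  finite index, so that it holds for some pair \<open>x \<noteq> y\<close>. By overspill it holds for some \<open>x \<noteq> y\<close> and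
  some nonstandard \<open>c\<close>, and taking least elements makes \<open>c\<close>, \<open>x\<close>, \<open>y\<close> fixed by all automorphisms.
  For nonstandard \<open>c\<close> the elements \<open>x\<close> and \<open>y\<close> satisfy the same infinitary formulas of the
  level below \<open>n\<close>, whereas the orbit of \<open>x\<close> is \<open>{x}\<close>. Hence no finite level defines it.

  Scott's theorem is also needed: without it the least ordinal in the definition of the Scott rank
  might not exist.
\<close>

section \<open>Countable ordinals\<close>

text \<open>A smaller well-order is isomorphic to an initial segment cut off by an element of the
  field. The field therefore bounds the number of predecessors; finiteness, countability and the
  minimality of 0 all come from this.\<close>

lemma below_cord_subset:
  assumes "Well_order r"
  shows "{\<beta>. \<beta> < abs_cord r} \<subseteq> (\<lambda>a. abs_cord (Restr r (underS r a))) ` Field r"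
proof
  fix \<beta> assume "\<beta> \<in> {\<beta>. \<beta> < abs_cord r}"
  then have "\<beta> < abs_cord r" by simp
  then show "\<beta> \<in> (\<lambda>a. abs_cord (Restr r (underS r a))) ` Field r"
  proof (induction \<beta> rule: cord.abs_induct)
    case (1 s)
    then have s: "Well_order s" "(s, r) \<in> ordLess"
      using assms by (simp_all add: less_cord.abs_eq ordIso_self_iff)
    then obtain a where a: "a \<in> Field r" "(s, Restr r (underS r a)) \<in> ordIso"
      using ordLess_iff_ordIso_Restr[OF assms s(1)] by blast
    have "abs_cord s = abs_cord (Restr r (underS r a))"
      using a(2) Quotient3_rel[OF Quotient3_cord] by metis
    with a(1) show ?case by blast
  qed
qed

lemma finite_below_finite_cord:
  assumes "\<alpha> < omega"
  shows "finite {\<beta>. \<beta> < \<alpha>}"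
proof -
  have "\<alpha> \<in> {\<beta>. \<beta> < abs_cord natLeq}"
    using assms by (simp add: omega_def)
  then obtain a where a: "\<alpha> = abs_cord (Restr natLeq (underS natLeq a))"
    using below_cord_subset[OF natLeq_Well_order] by blast
  have "Field (Restr natLeq (underS natLeq a)) \<subseteq> {..<a}"
    by (auto simp: Field_def underS_def natLeq_def)
  then have "finite (Field (Restr natLeq (underS natLeq a)))"
    using finite_subset by blast
  then show ?thesis
    unfolding a
    by (rule finite_surj[OF _ below_cord_subset[OF Well_order_Restr[OF natLeq_Well_order]]])
qed

lemma countable_below_cord: "countable {\<beta> :: cord. \<beta> < \<alpha>}"
proof (induction \<alpha> rule: cord.abs_induct)
  case (1 r)
  then have "Well_order r" by (simp add: ordIso_self_iff)
  from below_cord_subset[OF this] show ?case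
    by (rule countable_subset) (rule countable_image, simp)
qed

text \<open>Burali-Forti: if there were only countably many such ordinals, their own order could be
  copied into the naturals and would represent an ordinal above all of them.\<close>

lemma uncountable_cord: "\<not> countable (UNIV :: cord set)"
proof
  assume "countable (UNIV :: cord set)"
  then obtain f :: "cord \<Rightarrow> nat" where f: "inj f"
    by (auto simp: countable_def)
  define r where "r = {(x, y :: cord). x \<le> y}"
  have Fr: "Field r = UNIV" by (auto simp: r_def Field_def)
  have wr: "Well_order r"
    unfolding Fr well_order_on_def linear_order_on_def partial_order_on_def preorder_on_def
  proof (intro conjI)
    have "r - Id = {(x, y). x < y}" by (auto simp: r_def)
    then show "wf (r - Id)" using wf by simp
  qed (auto simp: r_def refl_on_def trans_def antisym_def total_on_def)
  define R where "R = dir_image r f"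
  have wR: "Well_order R"
    unfolding R_def using Well_order_dir_image wr f by (metis inj_on_subset subset_UNIV)
  have R_iff: "(f x, f y) \<in> R \<longleftrightarrow> x \<le> y" for x y
    using f by (auto simp: R_def dir_image_def r_def inj_eq)
  have FR: "Field R = range f"
    by (simp add: R_def dir_image_Field Fr)
  have uS: "underS R (f x) = f ` {y. y < x}" for x
  proof -
    have "underS R (f x) \<subseteq> range f" using FR unfolding underS_def Field_def by blast
    moreover have "f y \<in> underS R (f x) \<longleftrightarrow> y < x" for y
      using R_iff[of y x] f by (auto simp: underS_def inj_eq)
    ultimately show ?thesis by auto
  qed
  have of: "wo_rel.ofilter R (underS R a)" for a
    using wR by (simp add: wo_rel_def wo_rel.underS_ofilter)
  define T where "T x = abs_cord (Restr R (underS R (f x)))" for x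
  have mono: "T x < T y" if "x < y" for x y
  proof -
    have "underS R (f x) < underS R (f y)" using that unfolding uS less_le inj_image_eq_iff[OF f] by force
    then have "(Restr R (underS R (f x)), Restr R (underS R (f y))) \<in> ordLess"
      using ofilter_subset_ordLess[OF wR of of] by blast
    then show ?thesis unfolding T_def
      by (simp add: less_cord.abs_eq ordIso_self_iff Well_order_Restr wR)
  qed
  have top: "T x < abs_cord R" for x
  proof -
    have "underS R (f x) < Field R" unfolding uS FR less_le inj_image_eq_iff[OF f] by force
    then have "(Restr R (underS R (f x)), R) \<in> ordLess"
      using ofilter_ordLess[OF wR of] by blast
    then show ?thesis unfolding T_def
      by (simp add: less_cord.abs_eq ordIso_self_iff Well_order_Restr wR)
  qed
  \<comment> \<open>A strictly increasing map on a well-order never falls below the identity: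
    \<open>T x < x\<close> would give \<open>T (T x) < T x\<close>, against the hypothesis at
    \<open>T x\<close>.\<close>
  have le: "x \<le> T x" for x
  proof (induction x rule: less_induct)
    case (less x)
    show ?case
      using less.IH[of "T x"] mono[of "T x" x] by force
  qed
  show False using top[of "abs_cord R"] le[of "abs_cord R"] by simp
qed

text \<open>Otherwise \<open>S\<close> would be cofinal, and \<open>cord\<close> would be a
  countable union of countable sets.\<close>

lemma countable_cord_bounded:
  fixes S :: "cord set"
  assumes "countable S"
  shows "\<exists>\<alpha>. \<forall>\<beta>\<in>S. \<beta> < \<alpha>"
proof (rule ccontr)
  assume "\<not> ?thesis"
  then have "\<exists>\<beta>\<in>S. \<gamma> \<le> \<beta>" for \<gamma>
    by (meson not_less)
  then have "UNIV = (\<Union>\<beta>\<in>S. {\<gamma>. \<gamma> < \<beta>}) \<union> S"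
    unfolding order.order_iff_strict by blast
  moreover have "countable ((\<Union>\<beta>\<in>S. {\<gamma>. \<gamma> < \<beta>}) \<union> S)"
    using assms countable_below_cord by (intro countable_Un countable_UN)
  ultimately show False using uncountable_cord by simp
qed

lemma cord_nonneg: "(0 :: cord) \<le> \<alpha>"
proof (rule ccontr)
  assume "\<not> 0 \<le> \<alpha>"
  then have "\<alpha> \<in> {\<beta>. \<beta> < abs_cord {}}" by (simp add: zero_cord_def)
  with below_cord_subset[of "{}"] show False
    using well_order_on_empty by (auto simp: Field_def)
qed

text \<open>The number of predecessors measures a finite level; its strict decrease pays for the
  rounds in \<open>bf_equiv_hierarchy\<close>.\<close>

lemma card_below_less:
  fixes \<alpha> \<beta> :: cord
  assumes "finite {\<gamma>. \<gamma> < \<alpha>}" "\<beta> < \<alpha>"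
  shows "finite {\<gamma>. \<gamma> < \<beta>} \<and> card {\<gamma>. \<gamma> < \<beta>} < card {\<gamma>. \<gamma> < \<alpha>}"
proof -
  have "{\<gamma>. \<gamma> < \<beta>} \<subset> {\<gamma>. \<gamma> < \<alpha>}" using assms(2) by auto
  then show ?thesis using assms(1) psubset_card_mono finite_subset by blast
qed

section \<open>Scott's theorem\<close>

lemma eval_cong: "(\<And>v. v \<in> fv_tm t \<Longrightarrow> e v = e' v) \<Longrightarrow> eval M e t = eval M e' t"
  by (induction t) auto

lemma sat_cong: "(\<And>v. v \<in> fv \<phi> \<Longrightarrow> e v = e' v) \<Longrightarrow> sat M e \<phi> \<longleftrightarrow> sat M e' \<phi>"
proof (induction \<phi> arbitrary: e e')
  case (Eq s t)
  then show ?case using eval_cong[of s e e' M] eval_cong[of t e e' M] by auto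
next
  case (Lt s t)
  then show ?case using eval_cong[of s e e' M] eval_cong[of t e e' M] by auto
next
  case (Exists \<phi>)
  have "sat M (case_nat a e) \<phi> = sat M (case_nat a e') \<phi>" for a
    by (rule Exists.IH) (auto split: nat.split intro: Exists.prems)
  then show ?case by simp
next
  case (Forall \<phi>)
  have "sat M (case_nat a e) \<phi> = sat M (case_nat a e') \<phi>" for a
    by (rule Forall.IH) (auto split: nat.split intro: Forall.prems)
  then show ?case by simp
next
  case (And \<phi> \<psi>)
  then show ?case by (metis UnI1 UnI2 fv.simps(4) sat.simps(4))
next
  case (Or \<phi> \<psi>)
  then show ?case by (metis UnI1 UnI2 fv.simps(5) sat.simps(5))
next
  case (CConj I f)
  have "sat M e (f i) = sat M e' (f i)" if "i \<in> I" for i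
    by (rule CConj.IH) (use that CConj.prems in auto)
  then show ?case by simp
next
  case (CDisj I f)
  have "sat M e (f i) = sat M e' (f i)" if "i \<in> I" for i
    by (rule CDisj.IH) (use that CDisj.prems in auto)
  then show ?case by simp
next
  case (Neg \<phi>)
  then show ?case unfolding fv.simps sat.simps by blast
qed

lemma fv_Exists_pow: "fv ((Exists ^^ k) \<phi>) = {n. n + k \<in> fv \<phi>}"
  by (induction k) auto

lemma fv_Forall_pow: "fv ((Forall ^^ k) \<phi>) = {n. n + k \<in> fv \<phi>}"
  by (induction k) auto

text \<open>Induction step for blocks: the outermost of \<open>Suc k\<close> quantifiers supplies
  the entry at index \<open>k\<close>, the inner ones those below it.\<close>

lemma ex_env_Suc:
  "(\<exists>a e'. (\<forall>n. e' (n + k) = case_nat a e n) \<and> P e') \<longleftrightarrow>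
   (\<exists>e'. (\<forall>n. e' (n + Suc k) = e n) \<and> P e')" (is "?L \<longleftrightarrow> ?R")
proof
  assume ?L
  then obtain a e' where "\<forall>n. e' (n + k) = case_nat a e n" "P e'" by blast
  moreover from this(1) have "e' (n + Suc k) = e n" for n
    by (metis add_Suc_shift old.nat.simps(5))
  ultimately show ?R by blast
next
  assume ?R
  then obtain e' where e': "\<forall>n. e' (n + Suc k) = e n" "P e'" by blast
  have "e' (n + k) = case_nat (e' k) e n" for n
    using e'(1)[rule_format, of "n - 1"] by (cases n) auto
  with e'(2) show ?L by blast
qed

lemma sat_Exists_pow:
  "sat M e ((Exists ^^ k) \<phi>) \<longleftrightarrow> (\<exists>e'. (\<forall>n. e' (n + k) = e n) \<and> sat M e' \<phi>)"
proof (induction k arbitrary: e)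
  case 0
  have "(\<forall>n. e' n = e n) \<longleftrightarrow> e' = e" for e' by auto
  then show ?case by simp
next
  case (Suc k)
  then show ?case using ex_env_Suc[of k e "\<lambda>e'. sat M e' \<phi>"] by simp
qed

lemma sat_Neg_Forall_pow: "sat M e ((Forall ^^ k) \<phi>) \<longleftrightarrow> \<not> sat M e ((Exists ^^ k) (Neg \<phi>))"
  by (induction k arbitrary: e) auto

lemma sat_Forall_pow:
  "sat M e ((Forall ^^ k) \<phi>) \<longleftrightarrow> (\<forall>e'. (\<forall>n. e' (n + k) = e n) \<longrightarrow> sat M e' \<phi>)"
  unfolding sat_Neg_Forall_pow sat_Exists_pow sat.simps by blast

lemma automorphism_eval: "automorphism M h \<Longrightarrow> eval M (h \<circ> e) t = h (eval M e t)"
  by (induction t) (auto simp: automorphism_def)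

lemma automorphism_sat:
  assumes h: "automorphism M h"
  shows "sat M (h \<circ> e) \<phi> \<longleftrightarrow> sat M e \<phi>"
proof (induction \<phi> arbitrary: e)
  case (Eq s t)
  have "inj h" using h by (simp add: automorphism_def bij_is_inj)
  then show ?case unfolding sat.simps automorphism_eval[OF h] by (simp add: inj_eq)
next
  case (Lt s t)
  then show ?case
    using h unfolding sat.simps automorphism_eval[OF h] by (simp add: automorphism_def)
next
  case (Exists \<phi>)
  have *: "case_nat (h a) (h \<circ> e) = h \<circ> case_nat a e" for a by (auto split: nat.split)
  have "surj h" using h by (simp add: automorphism_def bij_is_surj)
  then have "(\<exists>a. sat M (case_nat a (h \<circ> e)) \<phi>) \<longleftrightarrow> (\<exists>a. sat M (case_nat (h a) (h \<circ> e)) \<phi>)"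
    by (metis surjD)
  then show ?case unfolding sat.simps * Exists.IH .
next
  case (Forall \<phi>)
  have *: "case_nat (h a) (h \<circ> e) = h \<circ> case_nat a e" for a by (auto split: nat.split)
  have "surj h" using h by (simp add: automorphism_def bij_is_surj)
  then have "(\<forall>a. sat M (case_nat a (h \<circ> e)) \<phi>) \<longleftrightarrow> (\<forall>a. sat M (case_nat (h a) (h \<circ> e)) \<phi>)"
    by (metis surjD)
  then show ?case unfolding sat.simps * Forall.IH .
qed auto

section \<open>Closure properties of the hierarchy\<close>

text \<open>The formula and the levels of its members stay the same. Level 0 is excluded because a
  finitary formula is never a \<open>CDisj\<close>.\<close>

lemma is_Sigma_mono:
  assumes "is_Sigma \<alpha> \<phi>" "0 < \<alpha>" "\<alpha> \<le> \<beta>"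
  shows "is_Sigma \<beta> \<phi>"
  using assms(1)
proof cases
  case (Sigma_pos I \<gamma> \<psi> k)
  have "0 < \<beta>" and "\<And>i. i \<in> I \<Longrightarrow> \<gamma> i < \<beta>"
    using Sigma_pos assms by force+
  with Sigma_pos show ?thesis using is_Sigma_is_Pi.Sigma_pos by metis
qed (use assms in auto)

lemma is_Sigma_Exists:
  assumes "is_Pi \<beta> \<phi>" "\<beta> < \<alpha>" "0 < \<alpha>"
  shows "is_Sigma \<alpha> (CDisj {0} (\<lambda>_. (Exists ^^ k) \<phi>))"
  using is_Sigma_is_Pi.Sigma_pos[of \<alpha> "{0}" "\<lambda>_. \<beta>" "\<lambda>_. \<phi>" "\<lambda>_. k"] assms by simp

lemma is_Pi_countable_conj:
  assumes "countable J" "0 < \<alpha>" "\<And>j. j \<in> J \<Longrightarrow> \<beta> j < \<alpha>" "\<And>j. j \<in> J \<Longrightarrow> is_Sigma (\<beta> j) (\<phi> j)"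
  shows "\<exists>\<psi>. is_Pi \<alpha> \<psi> \<and> fv \<psi> = (\<Union>j\<in>J. fv (\<phi> j)) \<and>
    (\<forall>(M :: 'a arith) e. sat M e \<psi> \<longleftrightarrow> (\<forall>j\<in>J. sat M e (\<phi> j)))"
proof -
  \<comment> \<open>Index sets consist of naturals, so \<open>J\<close> is enumerated; the
    quantifier blocks are empty.\<close>
  define g where "g = from_nat_into J"
  define I where "I = to_nat_on J ` J"
  have J: "g ` I = J" using assms(1) by (auto simp: g_def I_def image_image)
  have "is_Pi \<alpha> (CConj I (\<lambda>i. (Forall ^^ 0) (\<phi> (g i))))"
    using J assms by (intro is_Sigma_is_Pi.Pi_pos[where \<beta> = "\<lambda>i. \<beta> (g i)" and k = "\<lambda>_. 0"]) auto
  then show ?thesis using J by (intro exI[of _ "CConj I (\<lambda>i. (Forall ^^ 0) (\<phi> (g i)))"]) auto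
qed

text \<open>\<open>Neg\<close> occurs in the hierarchy only at level 0, so a negation has to be
  pushed through the countable connectives and the blocks by duality.\<close>

lemma negation_in_hierarchy:
  "is_Sigma \<alpha> \<phi> \<Longrightarrow> \<exists>\<psi>. is_Pi \<alpha> \<psi> \<and> fv \<psi> = fv \<phi> \<and> (\<forall>(M :: 'a arith) e. sat M e \<psi> \<longleftrightarrow> \<not> sat M e \<phi>)"
  "is_Pi \<alpha> \<phi> \<Longrightarrow> \<exists>\<psi>. is_Sigma \<alpha> \<psi> \<and> fv \<psi> = fv \<phi> \<and> (\<forall>(M :: 'a arith) e. sat M e \<psi> \<longleftrightarrow> \<not> sat M e \<phi>)"
proof (induction rule: is_Sigma_is_Pi.inducts)
  case (Sigma_0 \<phi>)
  then show ?case by (intro exI[of _ "Neg \<phi>"]) (auto intro: is_Sigma_is_Pi.Pi_0)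
next
  case (Pi_0 \<phi>)
  then show ?case by (intro exI[of _ "Neg \<phi>"]) (auto intro: is_Sigma_is_Pi.Sigma_0)
next
  case (Sigma_pos \<alpha> I \<beta> \<psi> k)
  then have "\<forall>i. \<exists>\<chi>. i \<in> I \<longrightarrow> is_Sigma (\<beta> i) \<chi> \<and> fv \<chi> = fv (\<psi> i) \<and>
    (\<forall>(M :: 'a arith) e. sat M e \<chi> \<longleftrightarrow> \<not> sat M e (\<psi> i))" by blast
  then obtain \<chi> where \<chi>: "\<And>i. i \<in> I \<Longrightarrow> is_Sigma (\<beta> i) (\<chi> i)" "\<And>i. i \<in> I \<Longrightarrow> fv (\<chi> i) = fv (\<psi> i)"
    "\<And>i (M :: 'a arith) e. i \<in> I \<Longrightarrow> sat M e (\<chi> i) \<longleftrightarrow> \<not> sat M e (\<psi> i)" by metis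
  have "is_Pi \<alpha> (CConj I (\<lambda>i. (Forall ^^ k i) (\<chi> i)))"
    using Sigma_pos \<chi> by (intro is_Sigma_is_Pi.Pi_pos[where \<beta> = \<beta>]) auto
  moreover have "sat M e ((Forall ^^ k i) (\<chi> i)) \<longleftrightarrow> \<not> sat M e ((Exists ^^ k i) (\<psi> i))"
    if "i \<in> I" for i e and M :: "'a arith"
    unfolding sat_Exists_pow sat_Forall_pow \<chi>(3)[OF that] by blast
  ultimately show ?case
    using \<chi>(2) by (intro exI[of _ "CConj I (\<lambda>i. (Forall ^^ k i) (\<chi> i))"])
      (simp add: fv_Exists_pow fv_Forall_pow)
next
  case (Pi_pos \<alpha> I \<beta> \<psi> k)
  then have "\<forall>i. \<exists>\<chi>. i \<in> I \<longrightarrow> is_Pi (\<beta> i) \<chi> \<and> fv \<chi> = fv (\<psi> i) \<and>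
    (\<forall>(M :: 'a arith) e. sat M e \<chi> \<longleftrightarrow> \<not> sat M e (\<psi> i))" by blast
  then obtain \<chi> where \<chi>: "\<And>i. i \<in> I \<Longrightarrow> is_Pi (\<beta> i) (\<chi> i)" "\<And>i. i \<in> I \<Longrightarrow> fv (\<chi> i) = fv (\<psi> i)"
    "\<And>i (M :: 'a arith) e. i \<in> I \<Longrightarrow> sat M e (\<chi> i) \<longleftrightarrow> \<not> sat M e (\<psi> i)" by metis
  have "is_Sigma \<alpha> (CDisj I (\<lambda>i. (Exists ^^ k i) (\<chi> i)))"
    using Pi_pos \<chi> by (intro is_Sigma_is_Pi.Sigma_pos[where \<beta> = \<beta>]) auto
  moreover have "sat M e ((Exists ^^ k i) (\<chi> i)) \<longleftrightarrow> \<not> sat M e ((Forall ^^ k i) (\<psi> i))"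
    if "i \<in> I" for i e and M :: "'a arith"
    unfolding sat_Exists_pow sat_Forall_pow \<chi>(3)[OF that] by blast
  ultimately show ?case
    using \<chi>(2) by (intro exI[of _ "CDisj I (\<lambda>i. (Exists ^^ k i) (\<chi> i))"])
      (simp add: fv_Exists_pow fv_Forall_pow)
qed

section \<open>Equivalence of tuples, back-and-forth, and the existence of the rank\<close>

definition sigma_equiv :: "'a arith \<Rightarrow> 'a list \<Rightarrow> 'a list \<Rightarrow> bool" where
  "sigma_equiv M as bs \<longleftrightarrow> length as = length bs \<and>
     (\<forall>\<alpha> \<phi>. is_Sigma \<alpha> \<phi> \<longrightarrow> fv \<phi> \<subseteq> {..<length as} \<longrightarrow> sat M ((!) as) \<phi> \<longrightarrow> sat M ((!) bs) \<phi>)"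

text \<open>At any larger level a Pi formula becomes a Sigma formula, as a one-member disjunction
  with an empty block.\<close>

lemma sigma_equiv_Pi:
  assumes "sigma_equiv M as bs" "is_Pi \<alpha> \<phi>" "fv \<phi> \<subseteq> {..<length as}" "sat M ((!) as) \<phi>"
  shows "sat M ((!) bs) \<phi>"
proof -
  obtain \<beta> where \<beta>: "\<alpha> < \<beta>" using countable_cord_bounded[of "{\<alpha>}"] by auto
  then have "is_Sigma \<beta> (CDisj {0} (\<lambda>_. (Exists ^^ 0) \<phi>))"
    using is_Sigma_Exists assms(2) cord_nonneg order.strict_trans1 by blast
  moreover have "fv (CDisj {0} (\<lambda>_. (Exists ^^ 0) \<phi>)) = fv \<phi>"
    and sat: "\<And>e. sat M e (CDisj {0} (\<lambda>_. (Exists ^^ 0) \<phi>)) = sat M e \<phi>" by simp_all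
  ultimately show ?thesis using assms unfolding sigma_equiv_def by metis
qed

text \<open>The definition asks for preservation in one direction only; the converse follows by
  preserving the negated formula, which is Pi.\<close>

lemma sigma_equiv_sym:
  fixes M :: "'a arith"
  assumes "sigma_equiv M as bs"
  shows "sigma_equiv M bs as"
  unfolding sigma_equiv_def
proof (intro conjI allI impI)
  fix \<alpha> \<phi> assume \<phi>: "is_Sigma \<alpha> \<phi>" "fv \<phi> \<subseteq> {..<length bs}" "sat M ((!) bs) \<phi>"
  obtain \<psi> where "is_Pi \<alpha> \<psi>" "fv \<psi> = fv \<phi>" "\<forall>(M :: 'a arith) e. sat M e \<psi> \<longleftrightarrow> \<not> sat M e \<phi>"
    using negation_in_hierarchy(1)[OF \<phi>(1)] by blast
  then show "sat M ((!) as) \<phi>"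
    using sigma_equiv_Pi[OF assms, of \<alpha> \<psi>] \<phi> assms by (auto simp: sigma_equiv_def)
qed (use assms in \<open>simp add: sigma_equiv_def\<close>)

text \<open>Each tuple in \<open>B\<close> is refuted by some Sigma formula true of
  \<open>as\<close>; the conjunction of these countably many formulas is Pi at a level above all of
  theirs.\<close>

lemma separating_Pi:
  fixes M :: "'a arith"
  assumes "countable B" "\<And>bs. bs \<in> B \<Longrightarrow> length bs = length as \<and> \<not> sigma_equiv M as bs"
  shows "\<exists>\<alpha> \<psi>. is_Pi \<alpha> \<psi> \<and> fv \<psi> \<subseteq> {..<length as} \<and> sat M ((!) as) \<psi> \<and> (\<forall>bs\<in>B. \<not> sat M ((!) bs) \<psi>)"
proof -
  have "\<forall>bs. \<exists>\<alpha> \<phi>. bs \<in> B \<longrightarrow> is_Sigma \<alpha> \<phi> \<and> fv \<phi> \<subseteq> {..<length as} \<and>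
      sat M ((!) as) \<phi> \<and> \<not> sat M ((!) bs) \<phi>"
    using assms(2) unfolding sigma_equiv_def by metis
  then obtain \<beta> \<phi> where \<phi>: "\<And>bs. bs \<in> B \<Longrightarrow> is_Sigma (\<beta> bs) (\<phi> bs)"
    "\<And>bs. bs \<in> B \<Longrightarrow> fv (\<phi> bs) \<subseteq> {..<length as}"
    "\<And>bs. bs \<in> B \<Longrightarrow> sat M ((!) as) (\<phi> bs)" "\<And>bs. bs \<in> B \<Longrightarrow> \<not> sat M ((!) bs) (\<phi> bs)"
    by metis
  \<comment> \<open>Inserting 0 makes \<open>\<alpha>\<close> positive, as a countable conjunction
    requires.\<close>
  obtain \<alpha> where \<alpha>: "\<forall>\<gamma>\<in>insert 0 (\<beta> ` B). \<gamma> < \<alpha>"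
    using countable_cord_bounded[of "insert 0 (\<beta> ` B)"] assms(1) by auto
  obtain \<psi> where \<psi>: "is_Pi \<alpha> \<psi>" "fv \<psi> = (\<Union>bs\<in>B. fv (\<phi> bs))"
    "\<forall>(M :: 'a arith) e. sat M e \<psi> \<longleftrightarrow> (\<forall>bs\<in>B. sat M e (\<phi> bs))"
    using is_Pi_countable_conj[of B \<alpha> \<beta> \<phi>] assms(1) \<alpha> \<phi>(1) by auto
  show ?thesis
  proof (intro exI conjI ballI)
    show "is_Pi \<alpha> \<psi>" by (rule \<psi>(1))
    show "fv \<psi> \<subseteq> {..<length as}" unfolding \<psi>(2) using \<phi>(2) by (rule UN_least)
    show "sat M ((!) as) \<psi>" using \<psi>(3) \<phi>(3) by simp
    show "\<not> sat M ((!) bs) \<psi>" if "bs \<in> B" for bs using \<psi>(3) \<phi>(4)[OF that] that by auto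
  qed
qed

lemma nth_Cons_env: "(!) (a # as) = case_nat a ((!) as)"
  by (auto simp: nth_Cons)

text \<open>If every \<open>d\<close> failed, one Pi formula would separate \<open>c # as\<close>
  from all \<open>d # bs\<close>, and its existential quantification would hold of \<open>as\<close>
  but not of \<open>bs\<close>.\<close>

lemma sigma_equiv_forth:
  fixes M :: "'a arith"
  assumes "countable (UNIV :: 'a set)" "sigma_equiv M as bs"
  shows "\<exists>d. sigma_equiv M (c # as) (d # bs)"
proof (rule ccontr)
  assume no: "\<not> ?thesis"
  have len: "length as = length bs" using assms(2) by (simp add: sigma_equiv_def)
  have "countable (range (\<lambda>d. d # bs))" using assms(1) by simp
  then obtain \<alpha> \<psi> where \<psi>: "is_Pi \<alpha> \<psi>" "fv \<psi> \<subseteq> {..<length (c # as)}" "sat M ((!) (c # as)) \<psi>"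
    "\<forall>bs'\<in>range (\<lambda>d. d # bs). \<not> sat M ((!) bs') \<psi>"
    using separating_Pi[of "range (\<lambda>d. d # bs)" "c # as" M] no len by force
  obtain \<beta> where \<beta>: "\<alpha> < \<beta>" using countable_cord_bounded[of "{\<alpha>}"] by auto
  then have "is_Sigma \<beta> (CDisj {0} (\<lambda>_. (Exists ^^ 1) \<psi>))"
    using is_Sigma_Exists \<psi>(1) cord_nonneg order.strict_trans1 by blast
  moreover have "fv (CDisj {0} (\<lambda>_. (Exists ^^ 1) \<psi>)) \<subseteq> {..<length as}"
    using \<psi>(2) by auto
  moreover have sat: "sat M e (CDisj {0} (\<lambda>_. (Exists ^^ 1) \<psi>)) \<longleftrightarrow> (\<exists>a. sat M (case_nat a e) \<psi>)" for e
    by simp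
  ultimately have "\<exists>a. sat M (case_nat a ((!) bs)) \<psi>"
    using assms(2) \<psi>(3) unfolding sigma_equiv_def nth_Cons_env by metis
  then show False using \<psi>(4) by (auto simp: nth_Cons_env)
qed

lemma sigma_equiv_back:
  fixes M :: "'a arith"
  assumes "countable (UNIV :: 'a set)" "sigma_equiv M as bs"
  shows "\<exists>c. sigma_equiv M (c # as) (d # bs)"
  using sigma_equiv_forth[OF assms(1) sigma_equiv_sym[OF assms(2)]] sigma_equiv_sym by blast

lemma sigma_equiv_atomic:
  assumes "sigma_equiv M as bs" "i < length as" "j < length as" "k < length as"
  shows "as ! i = as ! j \<longleftrightarrow> bs ! i = bs ! j"
    and "less_rel M (as ! i) (as ! j) \<longleftrightarrow> less_rel M (bs ! i) (bs ! j)"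
    and "plus_op M (as ! i) (as ! j) = as ! k \<longleftrightarrow> plus_op M (bs ! i) (bs ! j) = bs ! k"
    and "times_op M (as ! i) (as ! j) = as ! k \<longleftrightarrow> times_op M (bs ! i) (bs ! j) = bs ! k"
    and "as ! i = Z M \<longleftrightarrow> bs ! i = Z M" and "as ! i = U M \<longleftrightarrow> bs ! i = U M"
proof -
  have "sat M ((!) as) \<phi> \<longleftrightarrow> sat M ((!) bs) \<phi>"
    if "quantifier_free \<phi>" "finitary \<phi>" "fv \<phi> \<subseteq> {..<length as}" for \<phi>
    using that assms(1) sigma_equiv_sym[OF assms(1)] is_Sigma_is_Pi.Sigma_0[of \<phi>]
    unfolding sigma_equiv_def by metis
  from this[of "Eq (Var i) (Var j)"] this[of "Lt (Var i) (Var j)"]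
    this[of "Eq (Add (Var i) (Var j)) (Var k)"] this[of "Eq (Mul (Var i) (Var j)) (Var k)"]
    this[of "Eq (Var i) Zero"] this[of "Eq (Var i) One"] assms(2-4)
  show "as ! i = as ! j \<longleftrightarrow> bs ! i = bs ! j"
    and "less_rel M (as ! i) (as ! j) \<longleftrightarrow> less_rel M (bs ! i) (bs ! j)"
    and "plus_op M (as ! i) (as ! j) = as ! k \<longleftrightarrow> plus_op M (bs ! i) (bs ! j) = bs ! k"
    and "times_op M (as ! i) (as ! j) = as ! k \<longleftrightarrow> times_op M (bs ! i) (bs ! j) = bs ! k"
    and "as ! i = Z M \<longleftrightarrow> bs ! i = Z M" and "as ! i = U M \<longleftrightarrow> bs ! i = U M"
    by auto
qed

text \<open>The back-and-forth construction along an enumeration of the countable universe; the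
  union of the finite matchings is the graph of the automorphism.\<close>

lemma sigma_equiv_automorphism:
  fixes M :: "'a arith"
  assumes cnt: "countable (UNIV :: 'a set)" and eq: "sigma_equiv M as bs"
  shows "\<exists>h. automorphism M h \<and> map h as = bs"
proof -
  define f where "f = from_nat_into (UNIV :: 'a set)"
  have f: "surj f" using cnt by (simp add: f_def)
  \<comment> \<open>Stage \<open>n\<close> treats \<open>f n\<close> twice: as a left entry answered
    by \<open>d\<close>, then as a right entry answered by \<open>c\<close>.\<close>
  have "\<exists>s. \<forall>n. sigma_equiv M (fst (s n)) (snd (s n)) \<and> (n = 0 \<longrightarrow> s n = (as, bs)) \<and>
    (\<exists>c d. s (Suc n) = (c # f n # fst (s n), f n # d # snd (s n)))"
  proof -
    have "\<exists>s. \<forall>n. (sigma_equiv M (fst (s n)) (snd (s n)) \<and> (n = 0 \<longrightarrow> s n = (as, bs))) \<and>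
      (\<exists>c d. s (Suc n) = (c # f n # fst (s n), f n # d # snd (s n)))"
    proof (rule dependent_nat_choice)
      show "\<exists>p. sigma_equiv M (fst p) (snd p) \<and> ((0::nat) = 0 \<longrightarrow> p = (as, bs))"
        using eq by auto
    next
      fix p n assume "sigma_equiv M (fst p) (snd p) \<and> (n = (0::nat) \<longrightarrow> p = (as, bs))"
      then obtain d where "sigma_equiv M (f n # fst p) (d # snd p)"
        using sigma_equiv_forth[OF cnt] by blast
      then obtain c where "sigma_equiv M (c # f n # fst p) (f n # d # snd p)"
        using sigma_equiv_back[OF cnt] by blast
      then show "\<exists>q. (sigma_equiv M (fst q) (snd q) \<and> (Suc n = 0 \<longrightarrow> q = (as, bs))) \<and>
          (\<exists>c d. q = (c # f n # fst p, f n # d # snd p))"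
        by (intro exI[of _ "(c # f n # fst p, f n # d # snd p)"]) auto
    qed
    then show ?thesis by auto
  qed
  then obtain s where s: "\<And>n. sigma_equiv M (fst (s n)) (snd (s n))" "s 0 = (as, bs)"
    "\<And>n. \<exists>c d. s (Suc n) = (c # f n # fst (s n), f n # d # snd (s n))"
    by metis
  define G where "G n = set (zip (fst (s n)) (snd (s n)))" for n
  have len: "length (fst (s n)) = length (snd (s n))" for n
    using s(1)[of n] by (simp add: sigma_equiv_def)
  have G_Suc: "\<exists>c d. G (Suc n) = {(c, f n), (f n, d)} \<union> G n" for n
    using s(3)[of n] by (force simp: G_def)
  have "G n \<subseteq> G (Suc n)" for n
    using G_Suc[of n] by auto
  then have mono: "G m \<subseteq> G n" if "m \<le> n" for m n
    using that by (rule lift_Suc_mono_le)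
  have G_nth: "\<exists>i<length (fst (s n)). x = fst (s n) ! i \<and> y = snd (s n) ! i" if "(x, y) \<in> G n" for n x y
    using that len[of n] by (auto simp: G_def set_zip)
  define GG where "GG = (\<Union>n. G n)"
  have common: "\<exists>n. p \<in> G n \<and> q \<in> G n \<and> r \<in> G n" if "p \<in> GG" "q \<in> GG" "r \<in> GG" for p q r
  proof -
    from that obtain i j k where "p \<in> G i" "q \<in> G j" "r \<in> G k" by (auto simp: GG_def)
    then show ?thesis
      using mono[of i "max i (max j k)"] mono[of j "max i (max j k)"] mono[of k "max i (max j k)"]
      by (metis in_mono max.cobounded1 max.coboundedI2 max.cobounded2)
  qed
  \<comment> \<open>Any three pairs of the union already lie in one stage. The equality clause makes
    the union functional and injective, the others make it a homomorphism.\<close>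
  have atomic: "(x = x' \<longleftrightarrow> y = y') \<and> (less_rel M x x' \<longleftrightarrow> less_rel M y y') \<and>
      (plus_op M x x' = x'' \<longleftrightarrow> plus_op M y y' = y'') \<and>
      (times_op M x x' = x'' \<longleftrightarrow> times_op M y y' = y'') \<and>
      (x = Z M \<longleftrightarrow> y = Z M) \<and> (x = U M \<longleftrightarrow> y = U M)"
    if G: "(x, y) \<in> GG" "(x', y') \<in> GG" "(x'', y'') \<in> GG" for x y x' y' x'' y''
  proof -
    from common[OF G] obtain n where "(x, y) \<in> G n" "(x', y') \<in> G n" "(x'', y'') \<in> G n" by blast
    then obtain i j k where "i < length (fst (s n))" "x = fst (s n) ! i" "y = snd (s n) ! i"
      "j < length (fst (s n))" "x' = fst (s n) ! j" "y' = snd (s n) ! j"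
      "k < length (fst (s n))" "x'' = fst (s n) ! k" "y'' = snd (s n) ! k"
      using G_nth by metis
    then show ?thesis using sigma_equiv_atomic[OF s(1)[of n], of i j k] by simp
  qed
  have dom: "\<exists>y. (x, y) \<in> GG" and ran: "\<exists>y. (y, x) \<in> GG" for x
  proof -
    obtain n where "x = f n" using f by (metis surjD)
    moreover obtain c d where "G (Suc n) = {(c, f n), (f n, d)} \<union> G n" using G_Suc by blast
    ultimately have "(x, d) \<in> G (Suc n)" "(c, x) \<in> G (Suc n)" by auto
    then show "\<exists>y. (x, y) \<in> GG" "\<exists>y. (y, x) \<in> GG" unfolding GG_def by blast+
  qed
  then obtain h where h: "\<And>x. (x, h x) \<in> GG" by metis
  have uniq: "h x = y" if "(x, y) \<in> GG" for x y
    using atomic[OF h[of x] that h[of x]] by simp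
  have "bij h"
  proof (rule bijI)
    show "inj h" using atomic h by (metis injI)
    show "surj h" using ran uniq by (metis surjI)
  qed
  moreover have "h (Z M) = Z M" "h (U M) = U M" using atomic h by blast+
  moreover have "h (plus_op M a b) = plus_op M (h a) (h b)" "h (times_op M a b) = times_op M (h a) (h b)"
    "less_rel M (h a) (h b) \<longleftrightarrow> less_rel M a b" for a b
    using atomic[OF h[of a] h[of b] h[of "plus_op M a b"]]
      atomic[OF h[of a] h[of b] h[of "times_op M a b"]] by auto
  ultimately have "automorphism M h" unfolding automorphism_def by blast
  moreover have "map h as = bs"
  proof (rule nth_equalityI)
    fix i assume "i < length (map h as)"
    then have "(as ! i, bs ! i) \<in> G 0" using len[of 0] s(2) by (auto simp: G_def set_zip)
    then show "map h as ! i = bs ! i" using uniq \<open>i < length (map h as)\<close> by (auto simp: GG_def)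
  qed (use len[of 0] s(2) in simp)
  ultimately show ?thesis by blast
qed

lemma orbit_eq_sigma_equiv:
  fixes M :: "'a arith"
  assumes "countable (UNIV :: 'a set)"
  shows "orbit M as = {bs. sigma_equiv M as bs}"
proof (intro equalityI subsetI)
  fix bs assume "bs \<in> orbit M as"
  then obtain h where h: "automorphism M h" "bs = map h as" by (auto simp: orbit_def)
  have "sat M ((!) bs) \<phi> \<longleftrightarrow> sat M ((!) as) \<phi>" if "fv \<phi> \<subseteq> {..<length as}" for \<phi>
  proof -
    have "sat M ((!) bs) \<phi> \<longleftrightarrow> sat M (h \<circ> (!) as) \<phi>"
      using that h(2) by (intro sat_cong) (auto simp: subset_eq)
    then show ?thesis using automorphism_sat[OF h(1)] by blast
  qed
  then show "bs \<in> {bs. sigma_equiv M as bs}" using h(2) by (simp add: sigma_equiv_def)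
next
  fix bs assume "bs \<in> {bs. sigma_equiv M as bs}"
  then show "bs \<in> orbit M as"
    using sigma_equiv_automorphism[OF assms] unfolding orbit_def by blast
qed

lemma sat_env_list:
  assumes "fv \<phi> \<subseteq> {..<n}"
  shows "sat M e \<phi> \<longleftrightarrow> sat M ((!) (map e [0..<n])) \<phi>"
  using assms by (intro sat_cong) (auto simp: subset_eq)

text \<open>There are only countably many tuples outside the class of \<open>as\<close>, so a single
  Pi formula excludes them all. Positivity of the level is recorded for
  \<open>is_Sigma_mono\<close>.\<close>

lemma orbit_Sigma_definable:
  fixes M :: "'a arith"
  assumes "countable (UNIV :: 'a set)"
  shows "\<exists>\<alpha> \<phi>. 0 < \<alpha> \<and> is_Sigma \<alpha> \<phi> \<and> defined_by M (length as) \<phi> (orbit M as)"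
proof -
  let ?B = "{bs. length bs = length as \<and> \<not> sigma_equiv M as bs}"
  have "countable (UNIV :: 'a list set)" using countable_lists[OF assms] by simp
  then have "countable ?B" by (rule countable_subset[OF subset_UNIV])
  then obtain \<alpha> \<psi> where \<psi>: "is_Pi \<alpha> \<psi>" "fv \<psi> \<subseteq> {..<length as}" "sat M ((!) as) \<psi>"
    "\<forall>bs\<in>?B. \<not> sat M ((!) bs) \<psi>"
    using separating_Pi[of ?B as M] by (metis (mono_tags, lifting) mem_Collect_eq)
  obtain \<beta> where \<beta>: "\<alpha> < \<beta>" using countable_cord_bounded[of "{\<alpha>}"] by auto
  then have "0 < \<beta>" using cord_nonneg order.strict_trans1 by blast
  then have "is_Sigma \<beta> (CDisj {0} (\<lambda>_. (Exists ^^ 0) \<psi>))"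
    using is_Sigma_Exists[OF \<psi>(1) \<beta>] by blast
  moreover have "sat M e \<psi> \<longleftrightarrow> sigma_equiv M as (map e [0..<length as])" for e
  proof -
    have "sigma_equiv M as (map e [0..<length as]) \<longleftrightarrow> sat M ((!) (map e [0..<length as])) \<psi>"
      using bspec[OF \<psi>(4), of "map e [0..<length as]"]
        sigma_equiv_Pi[OF _ \<psi>(1-3), of "map e [0..<length as]"] by auto
    then show ?thesis using sat_env_list[OF \<psi>(2), of M e] by blast
  qed
  ultimately show ?thesis
    using \<open>0 < \<beta>\<close> \<psi>(2) unfolding defined_by_def orbit_eq_sigma_equiv[OF assms]
    by (intro exI[of _ \<beta>] exI[of _ "CDisj {0} (\<lambda>_. (Exists ^^ 0) \<psi>)"]) auto
qed

theorem scott_rank_exists: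
  fixes M :: "'a arith"
  assumes "countable (UNIV :: 'a set)"
  shows "\<exists>\<alpha>. \<forall>as. \<exists>\<phi>. is_Sigma \<alpha> \<phi> \<and> defined_by M (length as) \<phi> (orbit M as)"
proof -
  obtain \<beta> \<phi> where *: "\<And>as. 0 < \<beta> as" "\<And>as. is_Sigma (\<beta> as) (\<phi> as)"
    "\<And>as. defined_by M (length as) (\<phi> as) (orbit M as)"
    using orbit_Sigma_definable[OF assms] by metis
  have "countable (UNIV :: 'a list set)" using countable_lists[OF assms] by simp
  then have "countable (range \<beta>)" by (rule countable_image)
  then obtain \<alpha> where "\<forall>\<gamma>\<in>range \<beta>. \<gamma> < \<alpha>" using countable_cord_bounded by blast
  then have "is_Sigma \<alpha> (\<phi> as)" for as
    using is_Sigma_mono[OF *(2) *(1), of as \<alpha>] by (simp add: less_imp_le)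
  with *(3) show ?thesis by blast
qed

text \<open>As a level with the required property exists, the \<open>LEAST\<close> in
  \<open>scott_rank\<close> is attained.\<close>

lemma scott_rank_defines:
  fixes M :: "'a arith"
  assumes "countable (UNIV :: 'a set)"
  shows "\<exists>\<phi>. is_Sigma (scott_rank M) \<phi> \<and> defined_by M (length as) \<phi> (orbit M as)"
  using LeastI_ex[OF scott_rank_exists[OF assms, of M]] unfolding scott_rank_def by blast

section \<open>Models of Peano arithmetic\<close>

lemma eval_subst: "eval M e (subst_tm \<sigma> t) = eval M (\<lambda>n. eval M e (\<sigma> n)) t"
  by (induction t) auto

lemma eval_lift_subst:
  "(\<lambda>n. eval M (case_nat a e) (lift_subst \<sigma> n)) = case_nat a (\<lambda>n. eval M e (\<sigma> n))"
  by (rule ext) (simp add: lift_subst_def eval_subst split: nat.split)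

lemma sat_subst: "sat M e (subst_fm \<sigma> \<phi>) \<longleftrightarrow> sat M (\<lambda>n. eval M e (\<sigma> n)) \<phi>"
  by (induction \<phi> arbitrary: e \<sigma>) (simp_all add: eval_subst eval_lift_subst)

fun subterms :: "tm \<Rightarrow> tm list" where
  "subterms (Add s t) = Add s t # subterms s @ subterms t"
| "subterms (Mul s t) = Mul s t # subterms s @ subterms t"
| "subterms t = [t]"

lemma subterms_refl: "t \<in> set (subterms t)"
  by (cases t) auto

lemma subterms_Add: "Add s t \<in> set (subterms r) \<Longrightarrow> s \<in> set (subterms r) \<and> t \<in> set (subterms r)"
  by (induction r) (auto simp: subterms_refl)

lemma subterms_Mul: "Mul s t \<in> set (subterms r) \<Longrightarrow> s \<in> set (subterms r) \<and> t \<in> set (subterms r)"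
  by (induction r) (auto simp: subterms_refl)

lemma subterms_Var: "Var v \<in> set (subterms r) \<Longrightarrow> v \<in> fv_tm r"
  by (induction r) auto

text \<open>Recoding in \<open>nat\<close> gives finite invariants a fixed codomain, so that an
  induction over rounds can assert their existence without a growing type.\<close>

lemma finite_range_nat_code:
  assumes "finite (range G)"
  shows "\<exists>F :: 'b \<Rightarrow> nat. finite (range F) \<and> (\<forall>x y. F x = F y \<longrightarrow> G x = G y)"
proof -
  let ?F = "\<lambda>x. to_nat_on (range G) (G x)"
  have "range ?F = to_nat_on (range G) ` range G" by blast
  moreover have "G x = G y" if "?F x = ?F y" for x y
    using that countable_finite[OF assms] by (simp add: to_nat_on_inj)
  ultimately show ?thesis using assms by (intro exI[of _ ?F]) auto
qed

section \<open>Order and standard numbers in a model\<close>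

locale pa_model =
  fixes M :: "'a arith"
  assumes pa: "M \<Turnstile> PA"
begin

abbreviation madd (infixl "\<oplus>" 65) where "x \<oplus> y \<equiv> plus_op M x y"
abbreviation mmul (infixl "\<otimes>" 70) where "x \<otimes> y \<equiv> times_op M x y"
abbreviation mless (infix "\<prec>" 50) where "x \<prec> y \<equiv> less_rel M x y"
abbreviation mzero ("\<zero>") where "\<zero> \<equiv> Z M"
abbreviation mone ("\<one>") where "\<one> \<equiv> U M"

lemma PA_minus_facts:
  shows madd_assoc: "x \<oplus> y \<oplus> z = x \<oplus> (y \<oplus> z)"
    and madd_comm: "x \<oplus> y = y \<oplus> x"
    and mmul_assoc: "x \<otimes> y \<otimes> z = x \<otimes> (y \<otimes> z)"
    and mmul_comm: "x \<otimes> y = y \<otimes> x"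
    and mdistrib: "x \<otimes> (y \<oplus> z) = x \<otimes> y \<oplus> x \<otimes> z"
    and madd_zero: "x \<oplus> \<zero> = x"
    and mmul_zero: "x \<otimes> \<zero> = \<zero>"
    and mmul_one: "x \<otimes> \<one> = x"
    and mless_trans: "x \<prec> y \<Longrightarrow> y \<prec> z \<Longrightarrow> x \<prec> z"
    and mless_irrefl: "\<not> x \<prec> x"
    and mless_linear: "x \<prec> y \<or> x = y \<or> y \<prec> x"
    and madd_mono: "x \<prec> y \<Longrightarrow> x \<oplus> z \<prec> y \<oplus> z"
    and mless_imp_add: "x \<prec> y \<Longrightarrow> \<exists>z. x \<oplus> z = y"
    and mzero_less_one: "\<zero> \<prec> \<one>"
    and mdiscrete: "\<zero> \<prec> x \<Longrightarrow> \<one> = x \<or> \<one> \<prec> x"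
    and mnonneg: "\<zero> = x \<or> \<zero> \<prec> x"
proof -
  \<comment> \<open>One environment gives the variables 0, 1, 2 of all axioms the values
    \<open>x\<close>, \<open>y\<close>, \<open>z\<close>.\<close>
  have "\<forall>\<phi>\<in>PA_minus. sat M (case_nat x (case_nat y (\<lambda>_. z))) \<phi>"
    using pa unfolding models_def PA_def by blast
  then have *: "x \<oplus> y \<oplus> z = x \<oplus> (y \<oplus> z) \<and> x \<oplus> y = y \<oplus> x \<and> x \<otimes> y \<otimes> z = x \<otimes> (y \<otimes> z) \<and>
    x \<otimes> y = y \<otimes> x \<and> x \<otimes> (y \<oplus> z) = x \<otimes> y \<oplus> x \<otimes> z \<and> x \<oplus> \<zero> = x \<and> x \<otimes> \<zero> = \<zero> \<and> x \<otimes> \<one> = x \<and>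
    (x \<prec> y \<and> y \<prec> z \<longrightarrow> x \<prec> z) \<and> \<not> x \<prec> x \<and> (x \<prec> y \<or> x = y \<or> y \<prec> x) \<and>
    (x \<prec> y \<longrightarrow> x \<oplus> z \<prec> y \<oplus> z) \<and> (\<zero> \<prec> z \<and> x \<prec> y \<longrightarrow> x \<otimes> z \<prec> y \<otimes> z) \<and>
    (x \<prec> y \<longrightarrow> (\<exists>z. x \<oplus> z = y)) \<and> \<zero> \<prec> \<one> \<and> (\<zero> \<prec> x \<longrightarrow> \<one> = x \<or> \<one> \<prec> x) \<and> (\<zero> = x \<or> \<zero> \<prec> x)"
    unfolding PA_minus_def Let_def numeral_2_eq_2 One_nat_def
    by (simp (no_asm_use) add: disj_imp del: disj_not1)
  from * show "x \<oplus> y \<oplus> z = x \<oplus> (y \<oplus> z)" by blast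
  from * show "x \<oplus> y = y \<oplus> x" by blast
  from * show "x \<otimes> y \<otimes> z = x \<otimes> (y \<otimes> z)" by blast
  from * show "x \<otimes> y = y \<otimes> x" by blast
  from * show "x \<otimes> (y \<oplus> z) = x \<otimes> y \<oplus> x \<otimes> z" by blast
  from * show "x \<oplus> \<zero> = x" by blast
  from * show "x \<otimes> \<zero> = \<zero>" by blast
  from * show "x \<otimes> \<one> = x" by blast
  from * show "x \<prec> y \<Longrightarrow> y \<prec> z \<Longrightarrow> x \<prec> z" by blast
  from * show "\<not> x \<prec> x" by blast
  from * show "x \<prec> y \<or> x = y \<or> y \<prec> x" by blast
  from * show "x \<prec> y \<Longrightarrow> x \<oplus> z \<prec> y \<oplus> z" by blast
  from * show "x \<prec> y \<Longrightarrow> \<exists>z. x \<oplus> z = y" by blast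
  from * show "\<zero> \<prec> \<one>" by blast
  from * show "\<zero> \<prec> x \<Longrightarrow> \<one> = x \<or> \<one> \<prec> x" by blast
  from * show "\<zero> = x \<or> \<zero> \<prec> x" by blast
qed

text \<open>This supplies semiring normalization and, through \<open>of_nat\<close>, the embedding
  of the standard numbers.\<close>

sublocale S: comm_semiring_1 where one = "\<one>" and times = "(\<otimes>)" and plus = "(\<oplus>)" and zero = "\<zero>"
proof
  show "\<zero> \<noteq> \<one>" using mzero_less_one mless_irrefl by metis
  show "\<zero> \<oplus> x = x" for x by (metis madd_comm madd_zero)
  show "\<one> \<otimes> x = x" for x by (metis mmul_comm mmul_one)
  show "(x \<oplus> y) \<otimes> z = x \<otimes> z \<oplus> y \<otimes> z" for x y z by (metis mmul_comm mdistrib)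
  show "\<zero> \<otimes> x = \<zero>" for x by (metis mmul_comm mmul_zero)
qed (rule madd_assoc madd_comm mmul_assoc mmul_comm mmul_zero)+

abbreviation num :: "nat \<Rightarrow> 'a" where "num \<equiv> S.of_nat"

lemma madd_cancel: "x \<oplus> z = y \<oplus> z \<Longrightarrow> x = y"
  by (metis madd_mono mless_irrefl mless_linear)

lemma not_madd_less: "\<not> x \<oplus> y \<prec> x"
  by (metis S.add_0_left madd_comm madd_mono mless_irrefl mless_trans mnonneg)

text \<open>By discreteness a positive difference is \<open>\<one>\<close> or
  \<open>\<one> \<oplus> w\<close>, so anything above \<open>y\<close> is at or above its
  successor.\<close>

lemma mless_add_one: "x \<prec> y \<oplus> \<one> \<longleftrightarrow> x \<prec> y \<or> x = y"
proof
  have y: "y \<prec> y \<oplus> \<one>" using madd_mono[OF mzero_less_one, of y] by (simp add: madd_comm)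
  show "x \<prec> y \<or> x = y \<Longrightarrow> x \<prec> y \<oplus> \<one>" using y mless_trans by blast
  assume x: "x \<prec> y \<oplus> \<one>"
  show "x \<prec> y \<or> x = y"
  proof (rule ccontr)
    assume "\<not> ?thesis"
    then have "y \<prec> x" using mless_linear by blast
    then obtain z where z: "x = y \<oplus> z" using mless_imp_add by blast
    with \<open>y \<prec> x\<close> have "z \<noteq> \<zero>" using mless_irrefl by auto
    then have "\<zero> \<prec> z" using mnonneg by metis
    then consider "\<one> = z" | w where "z = \<one> \<oplus> w" using mdiscrete mless_imp_add by metis
    then show False
      using x z mless_irrefl not_madd_less by cases (auto simp: madd_assoc[symmetric])
  qed
qed

lemma mpred_exists:
  assumes "x \<noteq> \<zero>"
  shows "\<exists>y. x = y \<oplus> \<one>"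
proof -
  have "\<zero> \<prec> x" using assms mnonneg by metis
  then show ?thesis using mdiscrete mless_imp_add by (metis S.add_0_left madd_comm)
qed

lemma mnot_less_zero: "\<not> x \<prec> \<zero>"
  using mnonneg mless_irrefl mless_trans by metis

lemma num_Suc: "num (Suc n) = num n \<oplus> \<one>"
  by (simp add: madd_comm)

lemma mless_num_iff: "x \<prec> num n \<longleftrightarrow> (\<exists>i<n. x = num i)"
proof (induction n)
  case 0
  then show ?case by (simp add: mnot_less_zero)
next
  case (Suc n)
  then show ?case unfolding num_Suc mless_add_one using less_Suc_eq by auto
qed

lemma num_less: "i < j \<Longrightarrow> num i \<prec> num j"
  using mless_num_iff by blast

lemma num_eq_iff: "num i = num j \<longleftrightarrow> i = j"
  by (metis linorder_neqE_nat mless_irrefl num_less)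

lemma num_less_iff: "num i \<prec> num j \<longleftrightarrow> i < j"
  using mless_num_iff num_eq_iff by metis

lemma num_less_nonstandard: "x \<notin> range num \<Longrightarrow> num n \<prec> x"
  using mless_num_iff mless_linear by (metis rangeI)

text \<open>Definability, phrased for predicates on environments so that it can be proved by
  introduction rules; \<open>e 0\<close> is the variable bound by the innermost quantifier.\<close>

definition definable :: "((nat \<Rightarrow> 'a) \<Rightarrow> bool) \<Rightarrow> bool" where
  "definable P \<longleftrightarrow> (\<exists>\<phi>. finitary \<phi> \<and> (\<forall>e. sat M e \<phi> \<longleftrightarrow> P e))"

definition term_definable :: "((nat \<Rightarrow> 'a) \<Rightarrow> 'a) \<Rightarrow> bool" where
  "term_definable f \<longleftrightarrow> (\<exists>t. \<forall>e. eval M e t = f e)"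

lemma term_definable_intros:
  "term_definable (\<lambda>e. e n)"
  "term_definable (\<lambda>_. \<zero>)"
  "term_definable (\<lambda>_. \<one>)"
  "term_definable f \<Longrightarrow> term_definable g \<Longrightarrow> term_definable (\<lambda>e. f e \<oplus> g e)"
  "term_definable f \<Longrightarrow> term_definable g \<Longrightarrow> term_definable (\<lambda>e. f e \<otimes> g e)"
  unfolding term_definable_def by (metis eval.simps)+

lemma definable_Not: "definable P \<Longrightarrow> definable (\<lambda>e. \<not> P e)"
  unfolding definable_def by (metis finitary.simps(3) sat.simps(3))

lemma definable_conj: "definable P \<Longrightarrow> definable Q \<Longrightarrow> definable (\<lambda>e. P e \<and> Q e)"
  unfolding definable_def by (metis finitary.simps(4) sat.simps(4))

lemma definable_eq: "term_definable f \<Longrightarrow> term_definable g \<Longrightarrow> definable (\<lambda>e. f e = g e)"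
  unfolding definable_def term_definable_def by (metis finitary.simps(1) sat.simps(1))

lemma definable_less: "term_definable f \<Longrightarrow> term_definable g \<Longrightarrow> definable (\<lambda>e. f e \<prec> g e)"
  unfolding definable_def term_definable_def by (metis finitary.simps(2) sat.simps(2))

lemma definable_ex:
  assumes "definable (\<lambda>e. P (e 0) (\<lambda>n. e (Suc n)))"
  shows "definable (\<lambda>e. \<exists>a. P a e)"
proof -
  obtain \<phi> where "finitary \<phi>" "\<And>e. sat M e \<phi> \<longleftrightarrow> P (e 0) (\<lambda>n. e (Suc n))"
    using assms by (auto simp: definable_def)
  then show ?thesis unfolding definable_def by (intro exI[of _ "Exists \<phi>"]) auto
qed

lemma definable_const: "definable (\<lambda>_. b)"
proof -
  have *: "definable (\<lambda>_. \<zero> = \<zero>)"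
    by (intro definable_eq term_definable_intros)
  show ?thesis using definable_Not[OF *] * by (cases b) simp_all
qed

lemma definable_imp: "definable P \<Longrightarrow> definable Q \<Longrightarrow> definable (\<lambda>e. P e \<longrightarrow> Q e)"
  using definable_Not[OF definable_conj[OF _ definable_Not, of P Q]] by simp

lemma definable_iff: "definable P \<Longrightarrow> definable Q \<Longrightarrow> definable (\<lambda>e. P e \<longleftrightarrow> Q e)"
  using definable_conj[OF definable_imp[of P Q] definable_imp[of Q P]]
  by (simp add: iff_conv_conj_imp)

lemma definable_all:
  assumes "definable (\<lambda>e. P (e 0) (\<lambda>n. e (Suc n)))"
  shows "definable (\<lambda>e. \<forall>a. P a e)"
  using definable_Not[OF definable_ex[OF definable_Not[OF assms]]] by simp

lemma definable_ball_finite: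
  assumes "finite J" "\<And>j. j \<in> J \<Longrightarrow> definable (P j)"
  shows "definable (\<lambda>e. \<forall>j\<in>J. P j e)"
  using assms by (induction J rule: finite_induct) (simp_all add: definable_const definable_conj)

lemmas definable_intros = definable_Not definable_conj definable_eq definable_less definable_ex
  definable_const definable_imp definable_iff definable_all term_definable_intros

lemma definable_induct:
  assumes "definable Q" and 0: "Q (case_nat \<zero> e)"
    and step: "\<And>a. Q (case_nat a e) \<Longrightarrow> Q (case_nat (a \<oplus> \<one>) e)"
  shows "Q (case_nat a e)"
proof -
  obtain \<phi> where \<phi>: "finitary \<phi>" "\<And>e. sat M e \<phi> \<longleftrightarrow> Q e"
    using assms(1) by (auto simp: definable_def)
  have "sat M e (induction_axiom \<phi>)"
    using pa \<phi>(1) unfolding models_def PA_def by blast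
  moreover have "(\<lambda>n. eval M e (case n of 0 \<Rightarrow> Zero | Suc x \<Rightarrow> Var x)) = case_nat \<zero> e"
    by (auto split: nat.split)
  moreover have "(\<lambda>n. eval M (case_nat a e) (case n of 0 \<Rightarrow> Add (Var 0) One | Suc n \<Rightarrow> Var (Suc n))) =
      case_nat (a \<oplus> \<one>) e" for a
    by (auto split: nat.split)
  ultimately show ?thesis
    using 0 step by (auto simp: induction_axiom_def sat_subst \<phi>(2))
qed

text \<open>Strong induction: without a least element, induction on \<open>b\<close> shows that
  nothing below \<open>b\<close> satisfies \<open>Q\<close>; the bound
  \<open>a \<oplus> \<one>\<close> then excludes \<open>a\<close>.\<close>

lemma definable_least:
  assumes "definable Q" "Q (case_nat a e)"
  shows "\<exists>b. Q (case_nat b e) \<and> (\<forall>c. c \<prec> b \<longrightarrow> \<not> Q (case_nat c e))"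
proof (rule ccontr)
  assume no: "\<not> ?thesis"
  obtain \<phi> where \<phi>: "finitary \<phi>" "\<And>e. sat M e \<phi> \<longleftrightarrow> Q e"
    using assms(1) by (auto simp: definable_def)
  \<comment> \<open>Under the new quantifier \<open>c\<close> has index 0 and \<open>b\<close> index
    1; the renaming keeps index 0, skips \<open>b\<close> and moves the parameters to 2 and
    above.\<close>
  define \<psi> where "\<psi> = subst_fm (case_nat (Var 0) (\<lambda>n. Var (Suc (Suc n)))) \<phi>"
  have "(\<lambda>n. eval M (case_nat c (case_nat b e)) (case n of 0 \<Rightarrow> Var 0 | Suc n \<Rightarrow> Var (Suc (Suc n)))) =
      case_nat c e" for b c e
    by (auto split: nat.split)
  then have \<psi>: "sat M (case_nat c (case_nat b e)) \<psi> \<longleftrightarrow> Q (case_nat c e)" for b c e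
    by (simp add: \<psi>_def sat_subst \<phi>(2))
  have "finitary (subst_fm \<sigma> \<phi>)" for \<sigma>
    using \<phi>(1) by (induction \<phi> arbitrary: \<sigma>) auto
  then have fin: "finitary (Forall (Imp (Lt (Var 0) (Var 1)) (Neg \<psi>)))"
    by (simp add: \<psi>_def)
  let ?R = "\<lambda>e. sat M e (Forall (Imp (Lt (Var 0) (Var 1)) (Neg \<psi>)))"
  have R: "?R (case_nat b e) \<longleftrightarrow> (\<forall>c. c \<prec> b \<longrightarrow> \<not> Q (case_nat c e))" for b
    by (simp add: \<psi> disj_imp del: disj_not1)
  have "definable ?R" using fin unfolding definable_def by blast
  then have "?R (case_nat b e)" for b
  proof (rule definable_induct)
    show "?R (case_nat \<zero> e)" unfolding R by (simp add: mnot_less_zero)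
    show "?R (case_nat (b \<oplus> \<one>) e)" if "?R (case_nat b e)" for b
      using that no unfolding R mless_add_one by blast
  qed
  then show False using R[of "a \<oplus> \<one>"] assms(2) mless_add_one by blast
qed

section \<open>Elements fixed by all automorphisms\<close>

lemma automorphism_definable:
  assumes "automorphism M h" "definable Q"
  shows "Q (h \<circ> e) \<longleftrightarrow> Q e"
  using assms automorphism_sat[OF assms(1)] unfolding definable_def by metis

definition rigid :: "'a \<Rightarrow> bool" where
  "rigid a \<longleftrightarrow> (\<forall>h. automorphism M h \<longrightarrow> h a = a)"

text \<open>An automorphism fixing the parameters preserves the set defined by \<open>Q\<close>, so
  neither the image nor the preimage of \<open>a\<close> is below \<open>a\<close>. If
  \<open>a \<prec> h a\<close>, then the preimage would be below \<open>a\<close>.\<close>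

lemma least_rigid:
  assumes Q: "definable Q" and e: "\<And>n. rigid (e n)"
    and a: "Q (case_nat a e)" and least: "\<And>b. b \<prec> a \<Longrightarrow> \<not> Q (case_nat b e)"
  shows "rigid a"
  unfolding rigid_def
proof (intro allI impI)
  fix h assume h: "automorphism M h"
  then have "h \<circ> e = e" using e by (auto simp: rigid_def)
  then have comp: "h \<circ> case_nat b e = case_nat (h b) e" for b
    by (auto simp: fun_eq_iff split: nat.split)
  have inv: "Q (case_nat (h b) e) \<longleftrightarrow> Q (case_nat b e)" for b
    using automorphism_definable[OF h Q, of "case_nat b e"] unfolding comp by simp
  obtain b where b: "h b = a" using h by (metis automorphism_def bij_pointE)
  then have "\<not> b \<prec> a" "\<not> h a \<prec> a" using inv a least by blast+
  moreover have "b \<prec> a \<longleftrightarrow> a \<prec> h a" using h b by (auto simp: automorphism_def)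
  ultimately show "h a = a" using mless_linear by blast
qed

lemma rigid_num: "rigid (num n)"
proof (induction n)
  case 0
  then show ?case by (simp add: rigid_def automorphism_def)
next
  case (Suc n)
  then show ?case unfolding num_Suc rigid_def automorphism_def by metis
qed

lemma eval_num: "eval M (num \<circ> e) t = num (eval standard_model e t)"
  by (induction t) (simp_all add: standard_model_def)

text \<open>Tarski--Vaught test: least witnesses with standard parameters are rigid.\<close>

lemma standard_elementary:
  assumes std: "\<And>a. rigid a \<Longrightarrow> a \<in> range num" and "finitary \<phi>"
  shows "sat M (num \<circ> e) \<phi> \<longleftrightarrow> sat standard_model e \<phi>"
  using assms(2)
proof (induction \<phi> arbitrary: e)
  case (Eq s t)
  then show ?case unfolding sat.simps eval_num by (simp add: num_eq_iff)
next
  case (Lt s t)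
  then show ?case unfolding sat.simps eval_num by (simp add: num_less_iff standard_model_def)
next
  case (Exists \<phi>)
  have *: "num \<circ> case_nat n e = case_nat (num n) (num \<circ> e)" for n
    by (auto split: nat.split)
  have "\<exists>n. sat M (case_nat (num n) (num \<circ> e)) \<phi>" if a: "sat M (case_nat a (num \<circ> e)) \<phi>" for a
  proof -
    have d: "definable (\<lambda>e. sat M e \<phi>)" using Exists.prems by (auto simp: definable_def)
    obtain b where b: "sat M (case_nat b (num \<circ> e)) \<phi>"
      "\<forall>c. c \<prec> b \<longrightarrow> \<not> sat M (case_nat c (num \<circ> e)) \<phi>"
      using definable_least[of "\<lambda>e. sat M e \<phi>", OF d a] by blast
    then have "rigid b" using least_rigid[OF d, of "num \<circ> e" b] rigid_num by auto
    with std b(1) show ?thesis by blast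
  qed
  moreover have "sat M (case_nat (num n) (num \<circ> e)) \<phi> \<longleftrightarrow> sat standard_model (case_nat n e) \<phi>" for n
    unfolding *[symmetric] using Exists by (metis finitary.simps(6))
  ultimately show ?case unfolding sat.simps by blast
next
  case (Forall \<phi>)
  have *: "num \<circ> case_nat n e = case_nat (num n) (num \<circ> e)" for n
    by (auto split: nat.split)
  have "\<exists>n. \<not> sat M (case_nat (num n) (num \<circ> e)) \<phi>" if a: "\<not> sat M (case_nat a (num \<circ> e)) \<phi>" for a
  proof -
    have "definable (\<lambda>e. sat M e \<phi>)" using Forall.prems by (auto simp: definable_def)
    then have d: "definable (\<lambda>e. \<not> sat M e \<phi>)" by (rule definable_Not)
    obtain b where b: "\<not> sat M (case_nat b (num \<circ> e)) \<phi>"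
      "\<forall>c. c \<prec> b \<longrightarrow> \<not> \<not> sat M (case_nat c (num \<circ> e)) \<phi>"
      using definable_least[of "\<lambda>e. \<not> sat M e \<phi>", OF d a] by blast
    then have "rigid b" using least_rigid[OF d, of "num \<circ> e" b] rigid_num by auto
    with std b(1) show ?thesis by blast
  qed
  moreover have "sat M (case_nat (num n) (num \<circ> e)) \<phi> \<longleftrightarrow> sat standard_model (case_nat n e) \<phi>" for n
    unfolding *[symmetric] using Forall by (metis finitary.simps(7))
  ultimately show ?case unfolding sat.simps by blast
qed auto

lemma rigid_nonstandard_exists:
  assumes "\<not> M \<Turnstile> true_arithmetic"
  shows "\<exists>a. rigid a \<and> a \<notin> range num"
proof (rule ccontr)
  assume "\<not> ?thesis"
  then have std: "\<And>a. rigid a \<Longrightarrow> a \<in> range num" by blast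
  have "sat M e \<phi>" if "\<phi> \<in> true_arithmetic" for \<phi> e
  proof -
    have \<phi>: "finitary \<phi>" "fv \<phi> = {}" "sat standard_model (\<lambda>_. 0) \<phi>"
      using that by (auto simp: true_arithmetic_def models_def)
    then have "sat M (num \<circ> (\<lambda>_. 0)) \<phi>" using standard_elementary[OF std] by blast
    then show ?thesis using sat_cong[of \<phi> e "num \<circ> (\<lambda>_. 0)"] \<phi>(2) by simp
  qed
  with assms show False by (auto simp: models_def)
qed


subsection \<open>Coding of finite sequences\<close>

text \<open>Congruence modulo \<open>m\<close>; for lack of subtraction, multiples of
  \<open>m\<close> are added on both sides.\<close>

definition mcong :: "'a \<Rightarrow> 'a \<Rightarrow> 'a \<Rightarrow> bool" where
  "mcong m x y \<longleftrightarrow> (\<exists>s t. x \<oplus> s \<otimes> m = y \<oplus> t \<otimes> m)"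

lemma mcong_refl: "mcong m x x"
  by (auto simp: mcong_def)

lemma mcong_trans:
  assumes "mcong m x y" "mcong m y z"
  shows "mcong m x z"
proof -
  obtain s t s' t' where 1: "x \<oplus> s \<otimes> m = y \<oplus> t \<otimes> m" and 2: "y \<oplus> s' \<otimes> m = z \<oplus> t' \<otimes> m"
    using assms by (auto simp: mcong_def)
  have "x \<oplus> (s \<oplus> s') \<otimes> m = (x \<oplus> s \<otimes> m) \<oplus> s' \<otimes> m"
    by (simp add: algebra_simps)
  also have "\<dots> = (y \<oplus> s' \<otimes> m) \<oplus> t \<otimes> m" unfolding 1 by (simp add: algebra_simps)
  also have "\<dots> = z \<oplus> (t \<oplus> t') \<otimes> m" unfolding 2 by (simp add: algebra_simps)
  finally show ?thesis unfolding mcong_def by blast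
qed

lemma mcong_add:
  assumes "mcong m x y"
  shows "mcong m (x \<oplus> z) (y \<oplus> z)"
proof -
  obtain s t where 1: "x \<oplus> s \<otimes> m = y \<oplus> t \<otimes> m" using assms by (auto simp: mcong_def)
  have "x \<oplus> z \<oplus> s \<otimes> m = x \<oplus> s \<otimes> m \<oplus> z" by (simp add: algebra_simps)
  also have "\<dots> = y \<oplus> z \<oplus> t \<otimes> m" unfolding 1 by (simp add: algebra_simps)
  finally show ?thesis unfolding mcong_def by blast
qed

lemma mcong_mult:
  assumes "mcong m x y"
  shows "mcong m (z \<otimes> x) (z \<otimes> y)"
proof -
  obtain s t where 1: "x \<oplus> s \<otimes> m = y \<oplus> t \<otimes> m" using assms by (auto simp: mcong_def)
  have "z \<otimes> x \<oplus> (z \<otimes> s) \<otimes> m = z \<otimes> (x \<oplus> s \<otimes> m)" by (simp add: algebra_simps)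
  also have "\<dots> = z \<otimes> y \<oplus> (z \<otimes> t) \<otimes> m" unfolding 1 by (simp add: algebra_simps)
  finally show ?thesis unfolding mcong_def by blast
qed

text \<open>If more copies of \<open>m\<close> were added to \<open>x\<close> than to
  \<open>u\<close>, cancellation would make \<open>u\<close> at least \<open>m\<close>; otherwise
  the surplus on the side of \<open>u\<close> is the quotient.\<close>

lemma mcong_residue:
  assumes "mcong m x u" "u \<prec> m"
  shows "\<exists>q. x = q \<otimes> m \<oplus> u"
proof -
  obtain s t where st: "x \<oplus> s \<otimes> m = u \<oplus> t \<otimes> m" using assms by (auto simp: mcong_def)
  show ?thesis
  proof (cases "t \<prec> s")
    case True
    then obtain z where z: "s = t \<oplus> z" using mless_imp_add by metis
    with True have "z \<noteq> \<zero>" using mless_irrefl by auto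
    then obtain w where w: "z = w \<oplus> \<one>" using mpred_exists by blast
    have "(m \<oplus> (w \<otimes> m \<oplus> x)) \<oplus> t \<otimes> m = x \<oplus> s \<otimes> m"
      unfolding z w by (simp add: algebra_simps)
    then have "m \<oplus> (w \<otimes> m \<oplus> x) = u" unfolding st by (rule madd_cancel)
    then show ?thesis using assms(2) not_madd_less by blast
  next
    case False
    then obtain z where z: "t = s \<oplus> z"
      using mless_imp_add mless_linear by (metis madd_zero)
    have "x \<oplus> s \<otimes> m = (z \<otimes> m \<oplus> u) \<oplus> s \<otimes> m"
      unfolding st z by (simp add: algebra_simps)
    then show ?thesis using madd_cancel by blast
  qed
qed

text \<open>The moduli are of the form \<open>1 + c\<close>, so that \<open>c\<close> plays the role of \<open>-1\<close>.\<close>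

lemma chinese_remainder:
  fixes n :: nat
  assumes inv: "\<And>j k. j < k \<Longrightarrow> k < n \<Longrightarrow> \<exists>v. mcong (m k) (v \<otimes> m j) \<one>"
    and m: "\<And>k. k < n \<Longrightarrow> m k = \<one> \<oplus> c k" and u: "\<And>k. k < n \<Longrightarrow> u k \<prec> m k"
  shows "\<exists>a. \<forall>k<n. \<exists>q. a = q \<otimes> m k \<oplus> u k"
proof -
  \<comment> \<open>Invariant: \<open>a\<close> solves the first \<open>l\<close> congruences,
    \<open>p\<close> is a common multiple of their moduli, and \<open>p\<close> is invertible modulo
    each later modulus. The induction is external, as \<open>n\<close> is a standard number.\<close>
  have "\<exists>a p. (\<forall>k<l. \<exists>q. a = q \<otimes> m k \<oplus> u k) \<and> (\<forall>k<l. \<exists>q. p = q \<otimes> m k) \<and>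
      (\<forall>k<n. l \<le> k \<longrightarrow> (\<exists>v. mcong (m k) (v \<otimes> p) \<one>))" if "l \<le> n" for l
    using that
  proof (induction l)
    case 0
    have "mcong x (\<one> \<otimes> \<one>) \<one>" for x using mcong_refl by simp
    then show ?case by (intro exI[of _ \<one>]) blast
  next
    case (Suc l)
    then obtain a p where ap: "\<forall>k<l. \<exists>q. a = q \<otimes> m k \<oplus> u k" "\<forall>k<l. \<exists>q. p = q \<otimes> m k"
      "\<forall>k<n. l \<le> k \<longrightarrow> (\<exists>v. mcong (m k) (v \<otimes> p) \<one>)" by auto
    obtain v where v: "mcong (m l) (v \<otimes> p) \<one>"
      using ap(3)[rule_format, of l] Suc.prems by auto
    \<comment> \<open>Modulo \<open>m l\<close>, \<open>c l\<close> is -1, so \<open>w\<close>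
      stands for \<open>u l - a\<close>. Adding \<open>w\<close> times the inverse \<open>v\<close>
      times \<open>p\<close> repairs the residue at \<open>l\<close> and keeps the earlier
      ones.\<close>
    define w where "w = u l \<oplus> a \<otimes> c l"
    define a' where "a' = a \<oplus> (w \<otimes> v) \<otimes> p"
    have "mcong (m l) (w \<otimes> (v \<otimes> p) \<oplus> a) (w \<otimes> \<one> \<oplus> a)"
      using v by (intro mcong_add mcong_mult)
    moreover have "w \<otimes> \<one> \<oplus> a = u l \<oplus> a \<otimes> m l"
      using m[of l] Suc.prems unfolding w_def by (simp add: algebra_simps)
    moreover have "mcong (m l) (u l \<oplus> a \<otimes> m l) (u l)"
      unfolding mcong_def by (intro exI[of _ \<zero>] exI[of _ a]) simp
    moreover have "a' = w \<otimes> (v \<otimes> p) \<oplus> a" unfolding a'_def by (simp add: algebra_simps)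
    ultimately have "mcong (m l) a' (u l)" using mcong_trans by metis
    then have "\<exists>q. a' = q \<otimes> m l \<oplus> u l" using mcong_residue u Suc.prems by auto
    moreover have "\<exists>q. a' = q \<otimes> m k \<oplus> u k" if k: "k < l" for k
    proof -
      obtain q q' where q: "a = q \<otimes> m k \<oplus> u k" "p = q' \<otimes> m k" using ap k by blast
      have "a' = (q \<oplus> w \<otimes> v \<otimes> q') \<otimes> m k \<oplus> u k"
        unfolding a'_def q(2) by (subst q(1)) (simp add: algebra_simps)
      then show ?thesis by blast
    qed
    ultimately have 1: "\<forall>k<Suc l. \<exists>q. a' = q \<otimes> m k \<oplus> u k" using less_Suc_eq by auto
    have "\<exists>q. p \<otimes> m l = q \<otimes> m k" if k: "k < l" for k
    proof -
      obtain q where "p = q \<otimes> m k" using ap(2) k by blast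
      then have "p \<otimes> m l = (q \<otimes> m l) \<otimes> m k" by (simp add: algebra_simps)
      then show ?thesis by blast
    qed
    then have 2: "\<forall>k<Suc l. \<exists>q. p \<otimes> m l = q \<otimes> m k" using less_Suc_eq by auto
    have 3: "\<exists>v. mcong (m k) (v \<otimes> (p \<otimes> m l)) \<one>" if k: "k < n" "Suc l \<le> k" for k
    proof -
      obtain v1 where v1: "mcong (m k) (v1 \<otimes> p) \<one>" using ap(3) k by force
      obtain v2 where v2: "mcong (m k) (v2 \<otimes> m l) \<one>" using inv[of l k] k by auto
      have "mcong (m k) ((v2 \<otimes> m l) \<otimes> (v1 \<otimes> p)) ((v2 \<otimes> m l) \<otimes> \<one>)"
        using v1 by (rule mcong_mult)
      moreover have "(v2 \<otimes> m l) \<otimes> (v1 \<otimes> p) = (v1 \<otimes> v2) \<otimes> (p \<otimes> m l)"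
        by (simp add: algebra_simps)
      ultimately have "mcong (m k) ((v1 \<otimes> v2) \<otimes> (p \<otimes> m l)) (v2 \<otimes> m l)" by simp
      then show ?thesis using v2 mcong_trans by blast
    qed
    show ?case
    proof (intro exI conjI)
      show "\<forall>k<n. Suc l \<le> k \<longrightarrow> (\<exists>v. mcong (m k) (v \<otimes> (p \<otimes> m l)) \<one>)" using 3 by simp
    qed (rule 1 2)+
  qed
  from this[of n] show ?thesis by blast
qed

text \<open>Goedel's beta function, as a relation: a pair \<open>(a, b)\<close> codes the sequence of the remainders
  of \<open>a\<close> modulo \<open>1 + (i + 1) b\<close>.\<close>

definition beta :: "'a \<times> 'a \<Rightarrow> 'a \<Rightarrow> 'a \<Rightarrow> bool" where
  "beta p i u \<longleftrightarrow> (\<exists>q. fst p = q \<otimes> (\<one> \<oplus> (i \<oplus> \<one>) \<otimes> snd p) \<oplus> u) \<and> u \<prec> \<one> \<oplus> (i \<oplus> \<one>) \<otimes> snd p"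

text \<open>Uniqueness of division with remainder: distinct quotients would make one remainder at
  least the modulus.\<close>

lemma beta_unique:
  assumes "beta p i u" "beta p i v"
  shows "u = v"
proof -
  have *: False if "q \<otimes> m \<oplus> u = r \<otimes> m \<oplus> v" "u \<prec> m" "v \<prec> m" "r \<prec> q" for q r m u v
  proof -
    obtain z where z: "q = r \<oplus> z" using \<open>r \<prec> q\<close> mless_imp_add by metis
    with \<open>r \<prec> q\<close> have "z \<noteq> \<zero>" using mless_irrefl by auto
    then obtain w where w: "z = w \<oplus> \<one>" using mpred_exists by blast
    have "(m \<oplus> (w \<otimes> m \<oplus> u)) \<oplus> r \<otimes> m = q \<otimes> m \<oplus> u"
      unfolding z w by (simp add: algebra_simps)
    also have "\<dots> = v \<oplus> r \<otimes> m" unfolding that(1) by (simp add: algebra_simps)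
    finally have "m \<oplus> (w \<otimes> m \<oplus> u) = v" by (rule madd_cancel)
    then show False using \<open>v \<prec> m\<close> not_madd_less by blast
  qed
  define m where "m = \<one> \<oplus> (i \<oplus> \<one>) \<otimes> snd p"
  obtain q r where qr: "fst p = q \<otimes> m \<oplus> u" "fst p = r \<otimes> m \<oplus> v" "u \<prec> m" "v \<prec> m"
    using assms unfolding beta_def m_def by blast
  then have "q = r" using *[of q m u r v] *[of r m v q u] mless_linear[of q r] by auto
  then have "u \<oplus> q \<otimes> m = v \<oplus> q \<otimes> m" using qr by (metis madd_comm)
  then show ?thesis by (rule madd_cancel)
qed

text \<open>The modulus at index 0 is \<open>\<one> \<oplus> x\<close>, so the remainder is
  \<open>x\<close> with quotient 0. Thus the pair \<open>(x, x)\<close> can represent the single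
  element \<open>x\<close> in the game.\<close>

lemma beta_diagonal: "beta (x, x) \<zero> x"
proof -
  have "x \<prec> \<one> \<oplus> x" using mless_add_one by (metis madd_comm)
  moreover have "x = \<zero> \<otimes> (\<one> \<oplus> (\<zero> \<oplus> \<one>) \<otimes> x) \<oplus> x" by simp
  ultimately show ?thesis unfolding beta_def fst_conv snd_conv by (metis S.add_0_left S.mult_1_left)
qed

lemma mbound_list: "\<exists>w. \<zero> \<prec> w \<and> (\<forall>u\<in>set us. u \<prec> w)"
proof (induction us)
  case Nil
  then show ?case using mzero_less_one by auto
next
  case (Cons v us)
  then obtain w where "\<zero> \<prec> w" "\<forall>u\<in>set us. u \<prec> w" by blast
  moreover have "v \<prec> v \<oplus> \<one>" using mless_add_one by blast
  ultimately show ?case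
    using mless_linear[of "v \<oplus> \<one>" w] mless_trans by (metis set_ConsD)
qed

text \<open>Goedel's argument for lists of standard length with arbitrary, possibly nonstandard
  entries: the moduli are pairwise invertible and exceed all entries.\<close>

lemma beta_code: "\<exists>p. \<forall>j<length us. beta p (num j) (us ! j)"
proof -
  obtain w where w: "\<zero> \<prec> w" "\<forall>u\<in>set us. u \<prec> w" using mbound_list by blast
  define n where "n = length us"
  \<comment> \<open>The factorial makes \<open>b\<close> a multiple of every difference
    \<open>k - j\<close> of indices; the factor \<open>w\<close> makes the moduli large
    enough.\<close>
  define b where "b = num (fact n) \<otimes> w"
  define c where "c k = num (Suc k) \<otimes> b" for k
  define m where "m k = \<one> \<oplus> c k" for k
  have "\<exists>v. mcong (m k) (v \<otimes> m j) \<one>" if jk: "j < k" "k < n" for j k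
  proof -
    have "k - j dvd fact n" using jk by (intro dvd_fact) auto
    then obtain d where d: "fact n = (k - j) * d" by blast
    have "\<exists>d. num (k - j) \<otimes> d = b"
      unfolding b_def d by (intro exI[of _ "num d \<otimes> w"]) (simp only: S.of_nat_mult mmul_assoc)
    then obtain d where d: "num (k - j) \<otimes> d = b" by blast
    have "Suc k = (k - j) + Suc j" using jk by simp
    then have k: "num (Suc k) = num (k - j) \<oplus> num (Suc j)" by (metis S.of_nat_add)
    \<comment> \<open>Both products contain \<open>(k + 1)(j + 1) b\<close>; the rest differs by
      \<open>k - j\<close>. Multiplying by \<open>d\<close> turns this difference into
      \<open>b\<close>, so \<open>m j\<close> divides \<open>b\<close> modulo
      \<open>m k\<close>.\<close>
    have "num (Suc k) \<otimes> m j = num (Suc j) \<otimes> m k \<oplus> num (k - j)"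
    proof -
      have "num (Suc k) \<otimes> m j = num (Suc k) \<oplus> num (Suc k) \<otimes> (num (Suc j) \<otimes> b)"
        unfolding m_def c_def mdistrib mmul_one ..
      also have "num (Suc k) \<otimes> (num (Suc j) \<otimes> b) = num (Suc j) \<otimes> c k"
        unfolding c_def by (metis S.mult.left_commute)
      also have "num (Suc k) \<oplus> num (Suc j) \<otimes> c k = num (Suc j) \<otimes> m k \<oplus> num (k - j)"
        unfolding m_def mdistrib mmul_one k by (metis madd_comm madd_assoc)
      finally show ?thesis .
    qed
    then have "d \<otimes> (num (Suc k) \<otimes> m j) = (d \<otimes> num (Suc j)) \<otimes> m k \<oplus> b"
      unfolding d[symmetric] by (metis mdistrib mmul_assoc mmul_comm)
    then have "mcong (m k) (d \<otimes> (num (Suc k) \<otimes> m j)) b"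
      unfolding mcong_def by (intro exI[of _ \<zero>] exI[of _ "d \<otimes> num (Suc j)"]) (simp add: madd_comm)
    then have "mcong (m k) ((c k \<otimes> num (Suc k)) \<otimes> (d \<otimes> (num (Suc k) \<otimes> m j))) ((c k \<otimes> num (Suc k)) \<otimes> b)"
      by (rule mcong_mult)
    moreover have "(c k \<otimes> num (Suc k)) \<otimes> b = c k \<otimes> c k" unfolding c_def mmul_assoc ..
    \<comment> \<open>As \<open>c k\<close> is -1 modulo \<open>m k\<close>, its square is
      1.\<close>
    moreover have "mcong (m k) (c k \<otimes> c k) \<one>"
      unfolding mcong_def m_def by (intro exI[of _ \<one>] exI[of _ "c k"]) (simp add: algebra_simps)
    ultimately have "mcong (m k) ((c k \<otimes> num (Suc k)) \<otimes> (d \<otimes> (num (Suc k) \<otimes> m j))) \<one>"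
      using mcong_trans by metis
    moreover have "(c k \<otimes> num (Suc k)) \<otimes> (d \<otimes> (num (Suc k) \<otimes> m j)) =
        (c k \<otimes> num (Suc k) \<otimes> d \<otimes> num (Suc k)) \<otimes> m j"
      by (simp only: mmul_assoc)
    ultimately show ?thesis by metis
  qed
  moreover have "us ! k \<prec> m k" if "k < n" for k
  proof -
    have pos: "\<exists>x. num l \<otimes> y = y \<oplus> x" if l: "0 < l" for l y
    proof -
      obtain l' where "l = Suc l'" using l gr0_implies_Suc by blast
      then have "num l \<otimes> y = y \<oplus> num l' \<otimes> y" by (simp add: algebra_simps)
      then show ?thesis by blast
    qed
    obtain x where x: "c k = b \<oplus> x" using pos[of "Suc k" b] by (auto simp: c_def)
    obtain y where y: "b = w \<oplus> y" using pos[of "fact n" w] by (auto simp: b_def)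
    have "m k = w \<oplus> (y \<oplus> x \<oplus> \<one>)" unfolding m_def x y by (simp add: algebra_simps)
    moreover have "us ! k \<prec> w" using w(2) that by (simp add: n_def)
    ultimately show ?thesis by (metis mless_linear mless_trans not_madd_less)
  qed
  ultimately obtain a where a: "\<forall>k<n. \<exists>q. a = q \<otimes> m k \<oplus> us ! k"
    using chinese_remainder[of n m c "\<lambda>k. us ! k"] m_def by blast
  have "beta (a, b) (num k) (us ! k)" if "k < n" for k
    using a that \<open>\<And>k. k < n \<Longrightarrow> us ! k \<prec> m k\<close>[OF that]
    unfolding beta_def fst_conv snd_conv num_Suc[symmetric] m_def c_def by blast
  then show ?thesis unfolding n_def by blast
qed


subsection \<open>Bounded back-and-forth equivalence\<close>

text \<open>The number \<open>t\<close> ranges over the six atomic relations of unnested formulas.\<close>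

definition flat_rel :: "nat \<Rightarrow> 'a \<Rightarrow> 'a \<Rightarrow> 'a \<Rightarrow> bool" where
  "flat_rel t u v w \<longleftrightarrow> (if t = 0 then u = \<zero> else if t = 1 then u = \<one> else if t = 2 then u \<oplus> v = w
     else if t = 3 then u \<otimes> v = w else if t = 4 then u \<prec> v else u = v)"

text \<open>The relation is false when an entry is undefined, so a reflexive equality expresses that
  an entry exists.\<close>

definition flat_at :: "nat \<Rightarrow> 'a \<times> 'a \<Rightarrow> 'a \<Rightarrow> 'a \<times> 'a \<Rightarrow> 'a \<Rightarrow> 'a \<times> 'a \<Rightarrow> 'a \<Rightarrow> bool" where
  "flat_at t p i q j r k \<longleftrightarrow> (\<exists>u v w. beta p i u \<and> beta q j v \<and> beta r k w \<and> flat_rel t u v w)"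

text \<open>Relations and tuple positions range over finite sets and unfold to finite conjunctions,
  whereas the indices are quantified inside the model. This keeps the notion first-order with
  \<open>c\<close> as a variable.\<close>

definition flat_equiv :: "'a \<Rightarrow> ('a \<times> 'a) list \<Rightarrow> ('a \<times> 'a) list \<Rightarrow> bool" where
  "flat_equiv c X Y \<longleftrightarrow> length X = length Y \<and>
     (\<forall>t\<in>{..<6}. \<forall>j1\<in>{..<length X}. \<forall>j2\<in>{..<length X}. \<forall>j3\<in>{..<length X}.
        \<forall>i1 i2 i3. i1 \<prec> c \<longrightarrow> i2 \<prec> c \<longrightarrow> i3 \<prec> c \<longrightarrow>
          (flat_at t (X ! j1) i1 (X ! j2) i2 (X ! j3) i3 \<longleftrightarrow>
           flat_at t (Y ! j1) i1 (Y ! j2) i2 (Y ! j3) i3))"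

text \<open>
  The \<open>n\<close>-round back-and-forth game on tuples of codes of sequences, where the atomic relations are
  compared only at indices below \<open>c\<close>. Since a move is a code, it provides tuples of every standard
  length at once, which is what a countable disjunction of existential blocks of unbounded
  lengths requires. For standard \<open>c\<close> the relation has finite index; for nonstandard \<open>c\<close> it
  sees all standard indices.
\<close>

primrec bf_equiv :: "nat \<Rightarrow> 'a \<Rightarrow> ('a \<times> 'a) list \<Rightarrow> ('a \<times> 'a) list \<Rightarrow> bool" where
  "bf_equiv 0 c X Y \<longleftrightarrow> flat_equiv c X Y"
| "bf_equiv (Suc n) c X Y \<longleftrightarrow> flat_equiv c X Y \<and>
     (\<forall>a b. \<exists>a' b'. bf_equiv n c ((a, b) # X) ((a', b') # Y)) \<and>
     (\<forall>a' b'. \<exists>a b. bf_equiv n c ((a, b) # X) ((a', b') # Y))"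

lemma definable_flat_rel:
  "term_definable f \<Longrightarrow> term_definable g \<Longrightarrow> term_definable h \<Longrightarrow>
   definable (\<lambda>e. flat_rel t (f e) (g e) (h e))"
  unfolding flat_rel_def by (auto intro!: definable_intros)

lemma definable_flat_at:
  "definable (\<lambda>e. flat_at t (e a1, e b1) (e i1) (e a2, e b2) (e i2) (e a3, e b3) (e i3))"
  unfolding flat_at_def beta_def fst_conv snd_conv
  by (intro definable_intros definable_flat_rel)

abbreviation env_pairs :: "(nat \<Rightarrow> 'a) \<Rightarrow> (nat \<times> nat) list \<Rightarrow> ('a \<times> 'a) list" where
  "env_pairs e js \<equiv> map (\<lambda>j. (e (fst j), e (snd j))) js"

lemma definable_flat_equiv: "definable (\<lambda>e. flat_equiv (e c) (env_pairs e js) (env_pairs e ks))"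
proof (cases "length js = length ks")
  case True
  have "flat_equiv (e c) (env_pairs e js) (env_pairs e ks) \<longleftrightarrow>
    (\<forall>t\<in>{..<6}. \<forall>j1\<in>{..<length js}. \<forall>j2\<in>{..<length js}. \<forall>j3\<in>{..<length js}.
        \<forall>i1 i2 i3. i1 \<prec> e c \<longrightarrow> i2 \<prec> e c \<longrightarrow> i3 \<prec> e c \<longrightarrow>
          (flat_at t (e (fst (js ! j1)), e (snd (js ! j1))) i1 (e (fst (js ! j2)), e (snd (js ! j2))) i2
             (e (fst (js ! j3)), e (snd (js ! j3))) i3 \<longleftrightarrow>
           flat_at t (e (fst (ks ! j1)), e (snd (ks ! j1))) i1 (e (fst (ks ! j2)), e (snd (ks ! j2))) i2
             (e (fst (ks ! j3)), e (snd (ks ! j3))) i3))" for e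
    using True by (simp add: flat_equiv_def)
  then show ?thesis
    by (simp only:) (intro definable_ball_finite finite_lessThan definable_intros definable_flat_at)
next
  case False
  then show ?thesis by (simp add: flat_equiv_def definable_const)
qed

lemma definable_bf_equiv: "definable (\<lambda>e. bf_equiv n (e c) (env_pairs e js) (env_pairs e ks))"
proof (induction n arbitrary: c js ks)
  case 0
  then show ?case by (simp add: definable_flat_equiv)
next
  case (Suc n)
  \<comment> \<open>Each clause of a round has four quantifiers: the old variables move up by four,
    the challenge gets indices 3 and 2, the answer 1 and 0. In the back clause the challenge belongs
    to the right tuple.\<close>
  define sh :: "(nat \<times> nat) list \<Rightarrow> (nat \<times> nat) list" where
    "sh = map (\<lambda>j. (fst j + 4, snd j + 4))"
  have 1: "definable (\<lambda>e. bf_equiv n (e (Suc (Suc (Suc (Suc c)))))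
      ((e (Suc (Suc (Suc 0))), e (Suc (Suc 0))) # env_pairs (\<lambda>n. e (Suc (Suc (Suc (Suc n))))) js)
      ((e (Suc 0), e 0) # env_pairs (\<lambda>n. e (Suc (Suc (Suc (Suc n))))) ks))"
    using Suc.IH[of "c + 4" "(3, 2) # sh js" "(1, 0) # sh ks"]
    by (simp add: sh_def comp_def eval_nat_numeral)
  have 2: "definable (\<lambda>e. bf_equiv n (e (Suc (Suc (Suc (Suc c)))))
      ((e (Suc 0), e 0) # env_pairs (\<lambda>n. e (Suc (Suc (Suc (Suc n))))) js)
      ((e (Suc (Suc (Suc 0))), e (Suc (Suc 0))) # env_pairs (\<lambda>n. e (Suc (Suc (Suc (Suc n))))) ks))"
    using Suc.IH[of "c + 4" "(1, 0) # sh js" "(3, 2) # sh ks"]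
    by (simp add: sh_def comp_def eval_nat_numeral)
  show ?case unfolding bf_equiv.simps
    by (intro definable_conj definable_all definable_ex definable_flat_equiv 1 2)
qed

section \<open>Symmetry, and finite index for standard bounds\<close>

lemma flat_equiv_sym: "flat_equiv c X Y \<Longrightarrow> flat_equiv c Y X"
  by (simp add: flat_equiv_def)

lemma bf_equiv_sym: "bf_equiv n c X Y \<Longrightarrow> bf_equiv n c Y X"
proof (induction n arbitrary: X Y)
  case 0
  then show ?case by (simp add: flat_equiv_sym)
next
  case (Suc n)
  then show ?case unfolding bf_equiv.simps using flat_equiv_sym by meson
qed

lemma bf_equiv_flat: "bf_equiv n c X Y \<Longrightarrow> flat_equiv c X Y"
  by (cases n) auto

lemma bf_equiv_length: "bf_equiv n c X Y \<Longrightarrow> length X = length Y"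
  using bf_equiv_flat by (auto simp: flat_equiv_def)

text \<open>Below \<open>num m\<close> there are only the indices \<open>num i\<close> with
  \<open>i < m\<close>, so a finite table of truth values determines the class.\<close>

lemma flat_equiv_finite_index:
  "\<exists>F :: ('a \<times> 'a) list \<Rightarrow> nat. finite (range F) \<and>
     (\<forall>X Y. length X = l \<longrightarrow> length Y = l \<longrightarrow> F X = F Y \<longrightarrow> flat_equiv (num m) X Y)"
proof -
  define G where "G X = {(t, j1, j2, j3, i1, i2, i3) \<in> {..<6} \<times> {..<l} \<times> {..<l} \<times> {..<l} \<times> {..<m} \<times> {..<m} \<times> {..<m}.
    flat_at t (X ! j1) (num i1) (X ! j2) (num i2) (X ! j3) (num i3)}" for X
  have "range G \<subseteq> Pow ({..<6} \<times> {..<l} \<times> {..<l} \<times> {..<l} \<times> {..<m} \<times> {..<m} \<times> {..<m})"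
    unfolding G_def by blast
  then have "finite (range G)" by (rule finite_subset) simp
  then obtain F :: "('a \<times> 'a) list \<Rightarrow> nat" where F: "finite (range F)" "\<And>X Y. F X = F Y \<Longrightarrow> G X = G Y"
    using finite_range_nat_code by blast
  have "flat_equiv (num m) X Y" if "length X = l" "length Y = l" "F X = F Y" for X Y
  proof -
    have G: "(t, j1, j2, j3, i1, i2, i3) \<in> G X \<longleftrightarrow> (t, j1, j2, j3, i1, i2, i3) \<in> G Y" for t j1 j2 j3 i1 i2 i3
      using F(2)[OF that(3)] by simp
    have "flat_at t (X ! j1) (num i1) (X ! j2) (num i2) (X ! j3) (num i3) \<longleftrightarrow>
        flat_at t (Y ! j1) (num i1) (Y ! j2) (num i2) (Y ! j3) (num i3)"
      if "t < 6" "j1 < l" "j2 < l" "j3 < l" "i1 < m" "i2 < m" "i3 < m" for t j1 j2 j3 i1 i2 i3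
      using G[of t j1 j2 j3 i1 i2 i3] that by (simp add: G_def)
    then show ?thesis using that(1,2) unfolding flat_equiv_def mless_num_iff by auto
  qed
  with F(1) show ?thesis by blast
qed

text \<open>The invariant for one more round pairs the flat invariant with the set of invariants of
  all one-code extensions; a finite set has finitely many subsets.\<close>

lemma bf_equiv_finite_index:
  "\<exists>F :: ('a \<times> 'a) list \<Rightarrow> nat. finite (range F) \<and>
     (\<forall>X Y. length X = l \<longrightarrow> length Y = l \<longrightarrow> F X = F Y \<longrightarrow> bf_equiv n (num m) X Y)"
proof (induction n arbitrary: l)
  case 0
  then show ?case using flat_equiv_finite_index by simp
next
  case (Suc n)
  obtain F :: "('a \<times> 'a) list \<Rightarrow> nat" where F: "finite (range F)"
    "\<And>X Y. length X = Suc l \<Longrightarrow> length Y = Suc l \<Longrightarrow> F X = F Y \<Longrightarrow> bf_equiv n (num m) X Y"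
    using Suc by blast
  obtain F0 :: "('a \<times> 'a) list \<Rightarrow> nat" where F0: "finite (range F0)"
    "\<And>X Y. length X = l \<Longrightarrow> length Y = l \<Longrightarrow> F0 X = F0 Y \<Longrightarrow> flat_equiv (num m) X Y"
    using flat_equiv_finite_index by blast
  define G where "G X = (F0 X, range (\<lambda>p. F (p # X)))" for X
  have "range G \<subseteq> range F0 \<times> Pow (range F)" by (auto simp: G_def)
  then have "finite (range G)" using F(1) F0(1) by (meson finite_Pow_iff finite_SigmaI finite_subset)
  then obtain F' :: "('a \<times> 'a) list \<Rightarrow> nat" where F': "finite (range F')" "\<And>X Y. F' X = F' Y \<Longrightarrow> G X = G Y"
    using finite_range_nat_code by blast
  have "bf_equiv (Suc n) (num m) X Y" if len: "length X = l" "length Y = l" and eq: "F' X = F' Y" for X Y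
  proof -
    have "F0 X = F0 Y" and ran: "range (\<lambda>p. F (p # X)) = range (\<lambda>p. F (p # Y))"
      using F'(2)[OF eq] by (simp_all add: G_def)
    then have "flat_equiv (num m) X Y" using F0(2) len by blast
    moreover have "\<exists>a' b'. bf_equiv n (num m) ((a, b) # X) ((a', b') # Y)" for a b
    proof -
      have "F ((a, b) # X) \<in> range (\<lambda>p. F (p # Y))" unfolding ran[symmetric] by blast
      then obtain p where "F ((a, b) # X) = F (p # Y)" by blast
      then have "bf_equiv n (num m) ((a, b) # X) (p # Y)" using F(2) len by simp
      then show ?thesis by (metis surj_pair)
    qed
    moreover have "\<exists>a b. bf_equiv n (num m) ((a, b) # X) ((a', b') # Y)" for a' b'
    proof -
      have "F ((a', b') # Y) \<in> range (\<lambda>p. F (p # X))" unfolding ran by blast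
      then obtain p where "F (p # X) = F ((a', b') # Y)" by force
      then have "bf_equiv n (num m) (p # X) ((a', b') # Y)" using F(2) len by simp
      then show ?thesis by (metis surj_pair)
    qed
    ultimately show ?thesis by simp
  qed
  with F'(1) show ?case by blast
qed

text \<open>Pigeonhole: the universe contains infinitely many standard numbers, but there are
  finitely many classes.\<close>

lemma bf_equiv_pair_exists: "\<exists>x y. x \<noteq> y \<and> bf_equiv n (num m) [(x, x)] [(y, y)]"
proof -
  obtain F :: "('a \<times> 'a) list \<Rightarrow> nat" where F: "finite (range F)"
    "\<And>X Y. length X = 1 \<Longrightarrow> length Y = 1 \<Longrightarrow> F X = F Y \<Longrightarrow> bf_equiv n (num m) X Y"
    using bf_equiv_finite_index by blast
  have "inj num" by (simp add: inj_def num_eq_iff)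
  then have "infinite (UNIV :: 'a set)" by (rule infinite_super[OF subset_UNIV range_inj_infinite])
  moreover have "finite (range (\<lambda>x. F [(x, x)]))"
    by (rule finite_subset[OF image_subsetI[OF rangeI] F(1)])
  ultimately have "\<not> inj (\<lambda>x. F [(x, x)])" using finite_imageD by blast
  then obtain x y where "x \<noteq> y" "F [(x, x)] = F [(y, y)]" by (auto simp: inj_def)
  then show ?thesis using F(2)[of "[(x, x)]" "[(y, y)]"] by auto
qed

section \<open>Transfer of formulas along the game\<close>

text \<open>The game matches codes, whereas formulas speak of entries: the two values of a variable
  must sit at the same standard index of corresponding codes.\<close>

definition linked :: "('a \<times> 'a) list \<Rightarrow> ('a \<times> 'a) list \<Rightarrow> nat set \<Rightarrow> (nat \<Rightarrow> 'a) \<Rightarrow> (nat \<Rightarrow> 'a) \<Rightarrow> bool" where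
  "linked X Y V e e' \<longleftrightarrow> (\<forall>v\<in>V. \<exists>j<length X. \<exists>i. beta (X ! j) (num i) (e v) \<and> beta (Y ! j) (num i) (e' v))"

lemma linked_sym: "length X = length Y \<Longrightarrow> linked X Y V e e' \<Longrightarrow> linked Y X V e' e"
  unfolding linked_def by metis

lemma linked_mono: "linked X Y V e e' \<Longrightarrow> W \<subseteq> V \<Longrightarrow> linked X Y W e e'"
  unfolding linked_def by blast

text \<open>A nonstandard \<open>c\<close> lies above every standard index, so the bounded
  comparison applies to all of them.\<close>

lemma flat_equivD:
  assumes "flat_equiv c X Y" "c \<notin> range num" "t < 6" "j1 < length X" "j2 < length X" "j3 < length X"
    "beta (X ! j1) (num i1) u" "beta (X ! j2) (num i2) v" "beta (X ! j3) (num i3) w" "flat_rel t u v w"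
  shows "\<exists>u v w. beta (Y ! j1) (num i1) u \<and> beta (Y ! j2) (num i2) v \<and> beta (Y ! j3) (num i3) w \<and> flat_rel t u v w"
proof -
  have "flat_at t (X ! j1) (num i1) (X ! j2) (num i2) (X ! j3) (num i3)"
    using assms unfolding flat_at_def by blast
  then have "flat_at t (Y ! j1) (num i1) (Y ! j2) (num i2) (Y ! j3) (num i3)"
    using assms(1,3-6) num_less_nonstandard[OF assms(2)] unfolding flat_equiv_def by auto
  then show ?thesis unfolding flat_at_def .
qed

lemma bf_equiv_forth:
  assumes "bf_equiv (Suc n) c X Y"
  shows "\<exists>p'. bf_equiv n c (p # X) (p' # Y)"
  using assms unfolding bf_equiv.simps by (metis surj_pair)

text \<open>One round of the game unnests the terms: play a code of the values of all subterms.\<close>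

lemma bf_equiv_terms:
  assumes bf: "bf_equiv (Suc n) c X Y" and c: "c \<notin> range num"
    and linked: "linked X Y (fv_tm r \<union> fv_tm s) e e'"
  shows "\<exists>p p' i j. flat_equiv c (p # X) (p' # Y) \<and>
    beta p (num i) (eval M e r) \<and> beta p' (num i) (eval M e' r) \<and>
    beta p (num j) (eval M e s) \<and> beta p' (num j) (eval M e' s)"
proof -
  define ts where "ts = subterms r @ subterms s"
  obtain p where p: "\<forall>i<length (map (eval M e) ts). beta p (num i) (map (eval M e) ts ! i)"
    using beta_code by blast
  then have p: "beta p (num i) (eval M e (ts ! i))" if "i < length ts" for i using that by simp
  obtain p' where "bf_equiv n c (p # X) (p' # Y)" using bf_equiv_forth[OF bf] by blast
  then have flat: "flat_equiv c (p # X) (p' # Y)" by (rule bf_equiv_flat)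
  note D = flat_equivD[OF flat c]
  \<comment> \<open>Each atomic relation among the entries of \<open>p\<close> carries over to
    \<open>p'\<close>; by induction on the term, \<open>beta_unique\<close> identifies the entries
    of \<open>p'\<close> with the values under \<open>e'\<close>.\<close>
  have p': "beta p' (num i) (eval M e' t)" if "i < length ts" "ts ! i = t" for i t
    using that
  proof (induction t arbitrary: i)
    case (Var v)
    then have "v \<in> fv_tm r \<union> fv_tm s"
      using nth_mem[of i ts] subterms_Var by (auto simp: ts_def)
    then obtain j k where jk: "j < length X" "beta (X ! j) (num k) (e v)" "beta (Y ! j) (num k) (e' v)"
      using linked unfolding linked_def by blast
    have "beta p (num i) (e v)" using p[of i] Var by simp
    \<comment> \<open>Relation 5 is equality; position 0 is the new code and \<open>Suc j\<close> is
      the old position \<open>j\<close>.\<close>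
    then have "\<exists>u v w. beta p' (num i) u \<and> beta (Y ! j) (num k) v \<and> beta p' (num i) w \<and> flat_rel 5 u v w"
      using D[of 5 0 "Suc j" 0 i "e v" k "e v" i "e v"] jk by (simp add: flat_rel_def)
    then show ?case using beta_unique[OF jk(3)] by (auto simp: flat_rel_def)
  next
    case Zero
    then have "beta p (num i) \<zero>" using p[of i] by simp
    then have "\<exists>u v w. beta p' (num i) u \<and> beta p' (num i) v \<and> beta p' (num i) w \<and> flat_rel 0 u v w"
      using D[of 0 0 0 0 i \<zero> i \<zero> i \<zero>] by (simp add: flat_rel_def)
    then show ?case by (auto simp: flat_rel_def)
  next
    case One
    then have "beta p (num i) \<one>" using p[of i] by simp
    then have "\<exists>u v w. beta p' (num i) u \<and> beta p' (num i) v \<and> beta p' (num i) w \<and> flat_rel 1 u v w"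
      using D[of 1 0 0 0 i \<one> i \<one> i \<one>] by (simp add: flat_rel_def)
    then show ?case by (auto simp: flat_rel_def)
  next
    case (Add t1 t2)
    then have "Add t1 t2 \<in> set ts" using nth_mem by metis
    then have "t1 \<in> set ts" "t2 \<in> set ts"
      using subterms_Add[of t1 t2 r] subterms_Add[of t1 t2 s] by (auto simp: ts_def)
    then obtain i1 i2 where i: "i1 < length ts" "ts ! i1 = t1" "i2 < length ts" "ts ! i2 = t2"
      by (metis in_set_conv_nth)
    have "\<exists>u v w. beta p' (num i1) u \<and> beta p' (num i2) v \<and> beta p' (num i) w \<and> flat_rel 2 u v w"
      using D[of 2 0 0 0 i1 "eval M e t1" i2 "eval M e t2" i "eval M e (Add t1 t2)"]
        p[of i] p[of i1] p[of i2] i Add.prems by (simp add: flat_rel_def)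
    then show ?case
      using beta_unique[OF Add.IH(1)[OF i(1,2)]] beta_unique[OF Add.IH(2)[OF i(3,4)]]
      by (auto simp: flat_rel_def)
  next
    case (Mul t1 t2)
    then have "Mul t1 t2 \<in> set ts" using nth_mem by metis
    then have "t1 \<in> set ts" "t2 \<in> set ts"
      using subterms_Mul[of t1 t2 r] subterms_Mul[of t1 t2 s] by (auto simp: ts_def)
    then obtain i1 i2 where i: "i1 < length ts" "ts ! i1 = t1" "i2 < length ts" "ts ! i2 = t2"
      by (metis in_set_conv_nth)
    have "\<exists>u v w. beta p' (num i1) u \<and> beta p' (num i2) v \<and> beta p' (num i) w \<and> flat_rel 3 u v w"
      using D[of 3 0 0 0 i1 "eval M e t1" i2 "eval M e t2" i "eval M e (Mul t1 t2)"]
        p[of i] p[of i1] p[of i2] i Mul.prems by (simp add: flat_rel_def)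
    then show ?case
      using beta_unique[OF Mul.IH(1)[OF i(1,2)]] beta_unique[OF Mul.IH(2)[OF i(3,4)]]
      by (auto simp: flat_rel_def)
  qed
  have "r \<in> set ts" "s \<in> set ts" by (simp_all add: ts_def subterms_refl)
  then obtain i j where "i < length ts" "ts ! i = r" "j < length ts" "ts ! j = s"
    by (metis in_set_conv_nth)
  then show ?thesis using flat p[of i] p[of j] p'[of i r] p'[of j s] by blast
qed

lemma bf_equiv_atomic:
  assumes "bf_equiv (Suc n) c X Y" and c: "c \<notin> range num"
    and "linked X Y (fv_tm r \<union> fv_tm s) e e'"
  shows "eval M e r = eval M e s \<longleftrightarrow> eval M e' r = eval M e' s"
    and "eval M e r \<prec> eval M e s \<longleftrightarrow> eval M e' r \<prec> eval M e' s"
proof -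
  obtain p p' i j where flat: "flat_equiv c (p # X) (p' # Y)" and
    b: "beta p (num i) (eval M e r)" "beta p (num j) (eval M e s)" and
    b': "beta p' (num i) (eval M e' r)" "beta p' (num j) (eval M e' s)"
    using bf_equiv_terms[OF assms] by blast
  \<comment> \<open>One direction is proved for arbitrary codes and environments, so that symmetry
    yields the other. The third argument merely repeats \<open>s\<close>.\<close>
  have *: "flat_rel t (eval M e' r) (eval M e' s) (eval M e' s)"
    if "flat_equiv c (p # X) (p' # Y)" "t < 6" "flat_rel t (eval M e r) (eval M e s) (eval M e s)"
      "beta p (num i) (eval M e r)" "beta p (num j) (eval M e s)"
      "beta p' (num i) (eval M e' r)" "beta p' (num j) (eval M e' s)" for t p p' X Y e e'
    using flat_equivD[OF that(1) c that(2), of 0 0 0 i "eval M e r" j "eval M e s" j "eval M e s"]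
      that(3-5) beta_unique[OF that(6)] beta_unique[OF that(7)] by auto
  have "flat_rel t (eval M e r) (eval M e s) (eval M e s) \<longleftrightarrow>
      flat_rel t (eval M e' r) (eval M e' s) (eval M e' s)" if "t < 6" for t
    using *[OF flat that _ b b'] *[OF flat_equiv_sym[OF flat] that _ b' b] by blast
  from this[of 4] this[of 5]
  show "eval M e r = eval M e s \<longleftrightarrow> eval M e' r = eval M e' s"
    and "eval M e r \<prec> eval M e s \<longleftrightarrow> eval M e' r \<prec> eval M e' s" by (simp_all add: flat_rel_def)
qed

lemma bf_equiv_quantifier_free:
  assumes "bf_equiv (Suc n) c X Y" "c \<notin> range num"
    and "finitary \<phi>" "quantifier_free \<phi>" "linked X Y (fv \<phi>) e e'"
  shows "sat M e \<phi> \<longleftrightarrow> sat M e' \<phi>"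
  using assms(3-5)
proof (induction \<phi>)
  case (Eq s t)
  then show ?case using bf_equiv_atomic[OF assms(1,2)] by simp
next
  case (Lt s t)
  then show ?case using bf_equiv_atomic[OF assms(1,2)] by simp
next
  case (And \<phi> \<psi>)
  then show ?case using linked_mono[of X Y "fv \<phi> \<union> fv \<psi>" e e'] by simp
next
  case (Or \<phi> \<psi>)
  then show ?case using linked_mono[of X Y "fv \<phi> \<union> fv \<psi>" e e'] by simp
qed simp_all

text \<open>One move handles a whole block of any length \<open>k\<close>: a code of the
  \<open>k\<close> new values is played, and the answering code is decoded into the new part of
  \<open>f'\<close>.\<close>

lemma bf_equiv_extend:
  assumes bf: "bf_equiv (Suc n) c X Y" and c: "c \<notin> range num"
    and linked: "linked X Y {v. v + k \<in> V} e e'" and f: "\<And>v. f (v + k) = e v"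
  shows "\<exists>p p' f'. bf_equiv n c (p # X) (p' # Y) \<and> (\<forall>v. f' (v + k) = e' v) \<and>
    linked (p # X) (p' # Y) V f f'"
proof -
  obtain p where p: "\<forall>i<length (map f [0..<k]). beta p (num i) (map f [0..<k] ! i)"
    using beta_code by blast
  then have p: "beta p (num i) (f i)" if "i < k" for i using that by simp
  obtain p' where bf': "bf_equiv n c (p # X) (p' # Y)" using bf_equiv_forth[OF bf] by blast
  then have flat: "flat_equiv c (p # X) (p' # Y)" by (rule bf_equiv_flat)
  \<comment> \<open>Transferring the equality of an entry with itself shows that the answer has an
    entry at index \<open>i\<close>.\<close>
  have "\<exists>u. beta p' (num i) u" if "i < k" for i
    using flat_equivD[OF flat c, of 5 0 0 0 i "f i" i "f i" i "f i"] p[OF that]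
    by (auto simp: flat_rel_def)
  then obtain g where g: "\<And>i. i < k \<Longrightarrow> beta p' (num i) (g i)" by metis
  define f' where "f' v = (if v < k then g v else e' (v - k))" for v
  have "linked (p # X) (p' # Y) V f f'"
    unfolding linked_def
  proof
    fix v assume v: "v \<in> V"
    show "\<exists>j<length (p # X). \<exists>i. beta ((p # X) ! j) (num i) (f v) \<and> beta ((p' # Y) ! j) (num i) (f' v)"
    proof (cases "v < k")
      case True
      then show ?thesis using p g by (intro exI[of _ 0]) (auto simp: f'_def)
    next
      case False
      then have "v - k \<in> {v. v + k \<in> V}" using v by simp
      then obtain j i where "j < length X" "beta (X ! j) (num i) (e (v - k))" "beta (Y ! j) (num i) (e' (v - k))"
        using linked unfolding linked_def by blast
      moreover have "f v = e (v - k)" using f[of "v - k"] False by simp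
      ultimately show ?thesis using False by (intro exI[of _ "Suc j"]) (auto simp: f'_def)
    qed
  qed
  then show ?thesis using bf' by (intro exI[of _ p] exI[of _ p'] exI[of _ f']) (simp add: f'_def)
qed

lemma bf_equiv_Exists_pow:
  assumes c: "c \<notin> range num" and "bf_equiv (Suc n) c X Y" "linked X Y (fv ((Exists ^^ k) \<psi>)) e e'"
    and IH: "\<And>X Y e e'. bf_equiv n c X Y \<Longrightarrow> linked X Y (fv \<psi>) e e' \<Longrightarrow> sat M e \<psi> \<longleftrightarrow> sat M e' \<psi>"
  shows "sat M e ((Exists ^^ k) \<psi>) \<longleftrightarrow> sat M e' ((Exists ^^ k) \<psi>)"
proof -
  have *: "sat M e' ((Exists ^^ k) \<psi>)" if s: "sat M e ((Exists ^^ k) \<psi>)"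
    "bf_equiv (Suc n) c X Y" "linked X Y (fv ((Exists ^^ k) \<psi>)) e e'" for X Y e e'
  proof -
    obtain f where f: "\<And>v. f (v + k) = e v" "sat M f \<psi>" using s(1) unfolding sat_Exists_pow by blast
    then obtain p p' f' where "bf_equiv n c (p # X) (p' # Y)" "\<forall>v. f' (v + k) = e' v"
      "linked (p # X) (p' # Y) (fv \<psi>) f f'"
      using bf_equiv_extend[OF s(2) c, of k "fv \<psi>" e e' f] s(3) by (auto simp: fv_Exists_pow)
    with IH f(2) show ?thesis unfolding sat_Exists_pow by blast
  qed
  show ?thesis
    using *[OF _ assms(2,3)] *[OF _ bf_equiv_sym[OF assms(2)] linked_sym[OF bf_equiv_length[OF assms(2)] assms(3)]]
    by blast
qed

lemma bf_equiv_Forall_pow: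
  assumes c: "c \<notin> range num" and "bf_equiv (Suc n) c X Y" "linked X Y (fv ((Forall ^^ k) \<psi>)) e e'"
    and IH: "\<And>X Y e e'. bf_equiv n c X Y \<Longrightarrow> linked X Y (fv \<psi>) e e' \<Longrightarrow> sat M e \<psi> \<longleftrightarrow> sat M e' \<psi>"
  shows "sat M e ((Forall ^^ k) \<psi>) \<longleftrightarrow> sat M e' ((Forall ^^ k) \<psi>)"
  using bf_equiv_Exists_pow[OF c assms(2), of k "Neg \<psi>" e e'] assms(3) IH
  by (simp add: sat_Neg_Forall_pow fv_Exists_pow fv_Forall_pow)

text \<open>Each level costs one round, whatever the index set and the block lengths, and the extra
  round serves to unnest terms at level 0.\<close>

lemma bf_equiv_hierarchy:
  assumes c: "c \<notin> range num"
  shows "is_Sigma \<alpha> \<phi> \<Longrightarrow> finite {\<beta>. \<beta> < \<alpha>} \<Longrightarrow> card {\<beta>. \<beta> < \<alpha>} \<le> n \<Longrightarrow>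
      bf_equiv (Suc n) c X Y \<Longrightarrow> linked X Y (fv \<phi>) e e' \<Longrightarrow> sat M e \<phi> \<longleftrightarrow> sat M e' \<phi>"
    and "is_Pi \<alpha> \<phi> \<Longrightarrow> finite {\<beta>. \<beta> < \<alpha>} \<Longrightarrow> card {\<beta>. \<beta> < \<alpha>} \<le> n \<Longrightarrow>
      bf_equiv (Suc n) c X Y \<Longrightarrow> linked X Y (fv \<phi>) e e' \<Longrightarrow> sat M e \<phi> \<longleftrightarrow> sat M e' \<phi>"
proof (induction arbitrary: n X Y e e' and n X Y e e' rule: is_Sigma_is_Pi.inducts)
  case (Sigma_0 \<phi>)
  then show ?case using bf_equiv_quantifier_free[OF _ c] by blast
next
  case (Pi_0 \<phi>)
  then show ?case using bf_equiv_quantifier_free[OF _ c] by blast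
next
  case (Sigma_pos \<alpha> I \<beta> \<psi> k)
  have "sat M e ((Exists ^^ k i) (\<psi> i)) \<longleftrightarrow> sat M e' ((Exists ^^ k i) (\<psi> i))" if i: "i \<in> I" for i
  proof -
    note less = card_below_less[OF Sigma_pos.prems(1) Sigma_pos.hyps(2)[OF i]]
    \<comment> \<open>A member has a level with fewer predecessors, so \<open>n\<close> is positive;
      after the round spent on the block, \<open>n'\<close> still bounds that level.\<close>
    then obtain n' where n: "n = Suc n'" using Sigma_pos.prems(2) by (cases n) auto
    show ?thesis
    proof (rule bf_equiv_Exists_pow[OF c Sigma_pos.prems(3)])
      show "linked X Y (fv ((Exists ^^ k i) (\<psi> i))) e e'"
        by (rule linked_mono[OF Sigma_pos.prems(4)]) (use i in auto)
      show "sat M f (\<psi> i) \<longleftrightarrow> sat M f' (\<psi> i)" if "bf_equiv n c X Y" "linked X Y (fv (\<psi> i)) f f'" for X Y f f'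
        using Sigma_pos.IH[OF i _ _ that[unfolded n]] less Sigma_pos.prems(2) n by simp
    qed
  qed
  then show ?case by simp
next
  case (Pi_pos \<alpha> I \<beta> \<psi> k)
  have "sat M e ((Forall ^^ k i) (\<psi> i)) \<longleftrightarrow> sat M e' ((Forall ^^ k i) (\<psi> i))" if i: "i \<in> I" for i
  proof -
    note less = card_below_less[OF Pi_pos.prems(1) Pi_pos.hyps(2)[OF i]]
    then obtain n' where n: "n = Suc n'" using Pi_pos.prems(2) by (cases n) auto
    show ?thesis
    proof (rule bf_equiv_Forall_pow[OF c Pi_pos.prems(3)])
      show "linked X Y (fv ((Forall ^^ k i) (\<psi> i))) e e'"
        by (rule linked_mono[OF Pi_pos.prems(4)]) (use i in auto)
      show "sat M f (\<psi> i) \<longleftrightarrow> sat M f' (\<psi> i)" if "bf_equiv n c X Y" "linked X Y (fv (\<psi> i)) f f'" for X Y f f'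
        using Pi_pos.IH[OF i _ _ that[unfolded n]] less Pi_pos.prems(2) n by simp
    qed
  qed
  then show ?case by simp
qed

section \<open>Overspill and rigid inseparable pairs\<close>

lemma rigid_pred:
  assumes "rigid (a \<oplus> \<one>)"
  shows "rigid a"
  using assms madd_cancel unfolding rigid_def automorphism_def by metis

text \<open>Overspill: the first \<open>c\<close> without a pair is nonstandard and rigid, and so is its predecessor.\<close>

lemma rigid_pair_exists:
  assumes "\<not> M \<Turnstile> true_arithmetic"
  shows "\<exists>c x y. c \<notin> range num \<and> rigid x \<and> rigid y \<and> x \<noteq> y \<and> bf_equiv n c [(x, x)] [(y, y)]"
proof -
  define P where "P e \<longleftrightarrow> (\<exists>y x. x \<noteq> y \<and> bf_equiv n (e 0) [(x, x)] [(y, y)])" for e :: "nat \<Rightarrow> 'a"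
  have bf: "definable (\<lambda>e. bf_equiv n (e i) [(e j, e j)] [(e k, e k)])" for i j k
    using definable_bf_equiv[of n i "[(j, j)]" "[(k, k)]"] by simp
  have "definable (\<lambda>e. \<not> P e)" unfolding P_def by (intro definable_intros bf)
  define e0 where "e0 = (\<lambda>n :: nat. \<zero>)"
  have e0: "rigid (e0 n)" for n using rigid_num[of 0] by (simp add: e0_def)
  have "\<exists>c. rigid c \<and> c \<notin> range num \<and> P (case_nat c e0)"
  proof (cases "\<exists>c. \<not> P (case_nat c e0)")
    \<comment> \<open>If pairs exist for every bound, the rigid nonstandard element obtained from
      the failure of true arithmetic serves as \<open>c\<close>.\<close>
    case False
    then show ?thesis using rigid_nonstandard_exists[OF assms] by blast
  next
    case True
    then obtain c where c: "\<not> P (case_nat c e0)" "\<forall>b. b \<prec> c \<longrightarrow> \<not> \<not> P (case_nat b e0)"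
      using definable_least[OF \<open>definable (\<lambda>e. \<not> P e)\<close>] by blast
    then have rigid: "rigid c" using least_rigid[OF \<open>definable (\<lambda>e. \<not> P e)\<close>, of e0 c] e0 by blast
    have c': "c \<notin> range num"
    proof
      assume "c \<in> range num"
      then have "P (case_nat c e0)" using bf_equiv_pair_exists[of n] by (fastforce simp: P_def)
      with c(1) show False by blast
    qed
    then have "c \<noteq> \<zero>" using rangeI[of num 0] by auto
    then obtain d where d: "c = d \<oplus> \<one>" using mpred_exists by blast
    have "d \<notin> range num"
    proof
      assume "d \<in> range num"
      then obtain k where "d = num k" by blast
      then have "c = num (Suc k)" unfolding d num_Suc by simp
      with c' show False by blast
    qed
    moreover have "P (case_nat d e0)" using c(2) mless_add_one unfolding d by blast
    ultimately show ?thesis using rigid rigid_pred d by blast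
  qed
  then obtain c where c: "rigid c" "c \<notin> range num" "P (case_nat c e0)" by blast
  \<comment> \<open>With \<open>c\<close> fixed, the least possible \<open>y\<close> is rigid, and
    then so is the least \<open>x\<close> for this \<open>y\<close>.\<close>
  define Q where "Q e \<longleftrightarrow> (\<exists>x. x \<noteq> e 0 \<and> bf_equiv n (e 1) [(x, x)] [(e 0, e 0)])" for e :: "nat \<Rightarrow> 'a"
  have dQ: "definable Q" unfolding Q_def by (intro definable_intros bf)
  have e1: "rigid (case_nat c e0 n)" for n using c(1) e0 by (simp split: nat.split)
  obtain y0 where "Q (case_nat y0 (case_nat c e0))" using c(3) by (auto simp: P_def Q_def)
  then obtain y where y: "Q (case_nat y (case_nat c e0))" "\<forall>b. b \<prec> y \<longrightarrow> \<not> Q (case_nat b (case_nat c e0))"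
    using definable_least[OF dQ] by blast
  then have ry: "rigid y" using least_rigid[OF dQ, of "case_nat c e0" y] e1 by blast
  define R where "R e \<longleftrightarrow> e 0 \<noteq> e 1 \<and> bf_equiv n (e 2) [(e 0, e 0)] [(e 1, e 1)]" for e :: "nat \<Rightarrow> 'a"
  have dR: "definable R" unfolding R_def by (intro definable_intros bf)
  have e2: "rigid (case_nat y (case_nat c e0) n)" for n using ry e1 by (simp split: nat.split)
  obtain x0 where "R (case_nat x0 (case_nat y (case_nat c e0)))"
    using y(1) by (auto simp: Q_def R_def numeral_2_eq_2)
  then obtain x where x: "R (case_nat x (case_nat y (case_nat c e0)))"
      "\<forall>b. b \<prec> x \<longrightarrow> \<not> R (case_nat b (case_nat y (case_nat c e0)))"
    using definable_least[OF dR] by blast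
  then have "rigid x" using least_rigid[OF dR, of "case_nat y (case_nat c e0)" x] e2 by blast
  with x(1) c(2) ry show ?thesis by (auto simp: R_def numeral_2_eq_2)
qed

end

section \<open>No finite level defines all orbits\<close>

theorem theorem1p6:
  fixes M :: "'a arith"
  assumes "countable (UNIV :: 'a set)"
    and "M \<Turnstile> PA"
    and "\<not> M \<Turnstile> true_arithmetic"
  shows "omega \<le> scott_rank M"
proof (rule ccontr)
  assume "\<not> omega \<le> scott_rank M"
  then have fin: "finite {\<beta>. \<beta> < scott_rank M}" by (intro finite_below_finite_cord) simp
  interpret pa_model M by unfold_locales (rule assms(2))
  let ?n = "card {\<beta>. \<beta> < scott_rank M}"
  obtain c x y where c: "c \<notin> range num" and rigid: "rigid x" "rigid y" and "x \<noteq> y"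
    and bf: "bf_equiv (Suc ?n) c [(x, x)] [(y, y)]"
    using rigid_pair_exists[OF assms(3)] by blast
  have orbit: "orbit M [x] = {[x]}"
  proof -
    have "automorphism M id" by (simp add: automorphism_def)
    then have "map id [x] \<in> orbit M [x]" unfolding orbit_def by blast
    then show ?thesis using rigid(1) by (auto simp: orbit_def rigid_def)
  qed
  obtain \<phi> where \<phi>: "is_Sigma (scott_rank M) \<phi>" "defined_by M 1 \<phi> (orbit M [x])"
    using scott_rank_defines[OF assms(1), of M "[x]"] by auto
  \<comment> \<open>Under constant environments every variable has its value at index 0 of the
    single code.\<close>
  have "linked [(x, x)] [(y, y)] (fv \<phi>) (\<lambda>_. x) (\<lambda>_. y)"
    using beta_diagonal S.of_nat_0 unfolding linked_def by (metis length_Cons nth_Cons_0 zero_less_Suc)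
  then have "sat M (\<lambda>_. x) \<phi> \<longleftrightarrow> sat M (\<lambda>_. y) \<phi>"
    using bf_equiv_hierarchy(1)[OF c \<phi>(1) fin order.refl bf] by blast
  with \<phi>(2) \<open>x \<noteq> y\<close> show False by (simp add: defined_by_def orbit)
qed

end
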